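(* As formal power series, $A_{\{1,7\}}(x,y) = \dfrac{f}{g}$, where \begin{align*} f &=1 - x^4 y- x^5 y^2 - x^6 y^3 - 3 x^7 y - 2 x^8 y^2 - x^9 y^3 - x^{18} y^3 - x^{21} y^3 + 2 x^{11} y^2 \\ &\quad+ 2 x^{12} y^3 + 3 x^{14} y^2 + 2 x^{15} y^3,\\ g &= f\,(1-xy-x^7y^7) - 2x^7y^4- 2x^8y^2 - 2x^9y^3-2x^{10}y^4+2x^{12}y^3+4x^{13}y^4\\ &\quad+4x^{15}y^3+4x^{16}y^4-2x^{19}y^4 - 2x^{22}y^4, \end{align*} and for any integer $c \geq 1$, $A_{\{c,7c\}}(x,y) = A_{\{1,7\}}(x^c,y^c)$.
   Context: A composition of $n$ is an ordered list of positive integers (parts) with sum $n$; the empty list is the unique composition of $0$. A meander on $n$ nodes is a pair $\frac{\lambda}{\mu}$ of compositions of $n$, viewed as a planar (multi)graph on vertices $1,\dots,n$: for each part $a$ of $\lambda$, occupying the consecutive vertices $p+1,\dots,p+a$ (where $p$ is the sum of the preceding parts), there is an upper edge joining $p+i$ and $p+a+1-i$ for each $1\le i\le \lfloor a/2\rfloor$; lower edges are defined in the same way from $\mu$. If the same two vertices are joined by both an upper and a lower edge, both edges are kept and form a cycle. Every connected component is a cycle or a path (an isolated vertex counts as a path). The index is $\operatorname{ind}(\frac{\lambda}{\mu}) = 2c+p$, where here $c$ is the number of cycles and $p$ is the number of paths (this equals the index of the associated seaweed subalgebra of $\mathfrak{gl}_n$). For a set $J$ of positive integers, $a^J_{n,k}$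 is the number of meanders $\frac{\lambda}{\mu}$ on $n$ nodes of index $k$ such that all parts of $\lambda$ and $\mu$ lie in $J$, and $A_J(x,y)=\sum_{n,k\ge 0} a^J_{n,k}x^ny^k$ (the empty meander gives $a^J_{0,0}=1$). *)

theory Defs
  imports "HOL-Computational_Algebra.Computational_Algebra"
begin

subsection \<open>Multigraphs, paths and cycles\<close>

text \<open>A finite multigraph is given by a vertex set \<open>V\<close> and a set \<open>E\<close> of labelled edges
  \<open>(l, {u, v})\<close>; parallel edges differ in their label \<open>l\<close>.\<close>

definition adjacency :: "('l \<times> 'v set) set \<Rightarrow> ('v \<times> 'v) set" where
  "adjacency E = {(u, v). \<exists>e\<in>E. snd e = {u, v}}"

definition components :: "'v set \<Rightarrow> ('l \<times> 'v set) set \<Rightarrow> 'v set set" where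
  "components V E = V // (adjacency E)\<^sup>*"

definition edges_within :: "('l \<times> 'v set) set \<Rightarrow> 'v set \<Rightarrow> ('l \<times> 'v set) set" where
  "edges_within E C = {e \<in> E. snd e \<subseteq> C}"

definition is_path_graph :: "'v set \<Rightarrow> ('l \<times> 'v set) set \<Rightarrow> bool" where
  "is_path_graph C E \<longleftrightarrow> (\<exists>vs es.
     distinct vs \<and> set vs = C \<and> distinct es \<and> set es = E \<and>
     length vs = length es + 1 \<and>
     (\<forall>i<length es. snd (es ! i) = {vs ! i, vs ! (i + 1)}))"

text \<open>Two parallel edges between two vertices form a cycle of length 2.\<close>

definition is_cycle_graph :: "'v set \<Rightarrow> ('l \<times> 'v set) set \<Rightarrow> bool" where
  "is_cycle_graph C E \<longleftrightarrow> (\<exists>vs es.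
     vs \<noteq> [] \<and> distinct vs \<and> set vs = C \<and> distinct es \<and> set es = E \<and>
     length vs = length es \<and>
     (\<forall>i<length es. snd (es ! i) = {vs ! i, vs ! ((i + 1) mod length vs)}))"

definition num_paths :: "'v set \<Rightarrow> ('l \<times> 'v set) set \<Rightarrow> nat" where
  "num_paths V E = card {C \<in> components V E. is_path_graph C (edges_within E C)}"

definition num_cycles :: "'v set \<Rightarrow> ('l \<times> 'v set) set \<Rightarrow> nat" where
  "num_cycles V E = card {C \<in> components V E. is_cycle_graph C (edges_within E C)}"


subsection \<open>Meanders\<close>

definition is_composition :: "nat \<Rightarrow> nat list \<Rightarrow> bool" where
  "is_composition n as \<longleftrightarrow> (\<forall>a\<in>set as. 0 < a) \<and> sum_list as = n"

definition is_meander :: "nat \<Rightarrow> nat list \<times> nat list \<Rightarrow> bool" where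
  "is_meander n m \<longleftrightarrow> is_composition n (fst m) \<and> is_composition n (snd m)"

definition arcs :: "nat list \<Rightarrow> nat set set" where
  "arcs as = {{sum_list (take j as) + i, sum_list (take j as) + as ! j + 1 - i} | j i.
     j < length as \<and> 1 \<le> i \<and> i \<le> as ! j div 2}"

datatype side = Upper | Lower

definition meander_edges :: "nat list \<times> nat list \<Rightarrow> (side \<times> nat set) set" where
  "meander_edges m = {Upper} \<times> arcs (fst m) \<union> {Lower} \<times> arcs (snd m)"

definition meander_vertices :: "nat list \<times> nat list \<Rightarrow> nat set" where
  "meander_vertices m = {1..sum_list (fst m)}"

definition meander_index :: "nat list \<times> nat list \<Rightarrow> nat" where
  "meander_index m =
     2 * num_cycles (meander_vertices m) (meander_edges m)
       + num_paths (meander_vertices m) (meander_edges m)"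


subsection \<open>Bivariate generating functions\<close>

definition meander_count :: "nat set \<Rightarrow> nat \<Rightarrow> nat \<Rightarrow> nat" where
  "meander_count J n k =
     card {m. is_meander n m \<and> set (fst m) \<subseteq> J \<and> set (snd m) \<subseteq> J \<and> meander_index m = k}"

text \<open>A bivariate series in \<open>x\<close> and \<open>y\<close> is a power series in \<open>x\<close> whose coefficients are power
  series in \<open>y\<close>. Rational coefficients are used because \<open>/\<close> on series requires an
  inverse operation on the coefficients.\<close>

abbreviation X :: "rat fps fps" where "X \<equiv> fps_X"

abbreviation Y :: "rat fps fps" where "Y \<equiv> fps_const fps_X"

definition meander_gf :: "nat set \<Rightarrow> rat fps fps" where
  "meander_gf J = Abs_fps (\<lambda>n. Abs_fps (\<lambda>k. of_nat (meander_count J n k)))"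

text \<open>The substitution \<open>F(x, y) \<mapsto> F(x\<^sup>c, y\<^sup>c)\<close>, meaningful for \<open>c \<ge> 1\<close>.\<close>

definition subst_powers :: "nat \<Rightarrow> rat fps fps \<Rightarrow> rat fps fps" where
  "subst_powers c F = fps_compose (Abs_fps (\<lambda>n. fps_compose (F $ n) (fps_X ^ c))) (fps_X ^ c)"

definition f17 :: "rat fps fps" where
  "f17 = 1 - X^4 * Y - X^5 * Y^2 - X^6 * Y^3 - 3 * X^7 * Y - 2 * X^8 * Y^2 - X^9 * Y^3
     - X^18 * Y^3 - X^21 * Y^3 + 2 * X^11 * Y^2
     + 2 * X^12 * Y^3 + 3 * X^14 * Y^2 + 2 * X^15 * Y^3"

definition g17 :: "rat fps fps" where
  "g17 = f17 * (1 - X * Y - X^7 * Y^7)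
     - 2 * X^7 * Y^4 - 2 * X^8 * Y^2 - 2 * X^9 * Y^3 - 2 * X^10 * Y^4 + 2 * X^12 * Y^3
     + 4 * X^13 * Y^4 + 4 * X^15 * Y^3 + 4 * X^16 * Y^4 - 2 * X^19 * Y^4 - 2 * X^22 * Y^4"

text \<open>\<open>rat fps\<close> is not a field, so we confirm that \<open>/\<close> on \<open>rat fps fps\<close> is the genuine quotient
  by \<open>g17\<close>, whose constant coefficient is \<open>1\<close>.\<close>

lemma f17_nth_0: "f17 $ 0 = 1"
  by (simp add: f17_def fps_mult_nth_0 fps_power_zeroth)

lemma g17_nth_0: "g17 $ 0 = 1"
  by (simp add: g17_def f17_nth_0 fps_mult_nth_0 fps_power_zeroth)

lemma divide_g17_iff: "q = p / g17 \<longleftrightarrow> q * g17 = p"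
proof -
  have g: "g17 * fps_right_inverse g17 1 = 1"
    by (rule fps_right_inverse) (simp add: g17_nth_0)
  have inv: "inverse (1 :: rat fps) = 1"
    by simp
  have "subdegree g17 = 0"
    by (simp add: g17_nth_0)
  moreover have "g17 \<noteq> 0"
    using g17_nth_0 by auto
  ultimately have "p / g17 = p * inverse g17"
    by (simp add: fps_divide_def)
  also have "inverse g17 = fps_right_inverse g17 1"
    unfolding fps_inverse_def[of g17] g17_nth_0 inv ..
  finally have div: "p / g17 = p * fps_right_inverse g17 1" .
  show ?thesis
  proof
    assume "q = p / g17"
    then have "q * g17 = p * (g17 * fps_right_inverse g17 1)"
      by (simp only: div ac_simps)
    then show "q * g17 = p"
      by (simp only: g mult_1_right)
  next
    assume "q * g17 = p"
    then have "p / g17 = q * (g17 * fps_right_inverse g17 1)"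
      unfolding div mult.assoc[symmetric] by (simp only:)
    then show "q = p / g17"
      by (simp only: g mult_1_right)
  qed
qed

end

theory Submission
  imports Defs "HOL-Combinatorics.Orbits"
begin

text \<open>Let \<open>s\<close> and \<open>t\<close> be the involutions reversing the blocks of \<open>\<lambda>\<close> and of \<open>\<mu>\<close>. A path of the meander is a
  single cycle of the permutation \<open>s \<circ> t\<close> and a cycle of the meander splits into two of them, so the
  index is the number of cycles of \<open>s \<circ> t\<close>. The number of cycles is additive under passing to the first-return
  permutation on a subset (up to the cycles that avoid the subset), so a meander can be read from left to
  right, always extending the side that is behind and remembering only the permutation induced on
  the nodes that this side has not reached. With block sizes 1 and 7 only eight such states occur, and the
  resulting linear system for their generating functions is solved by elimination.

  If all block sizes are multiplied by \<open>c\<close>, then \<open>s\<close> sends \<open>c x + r\<close> to \<open>c s(x) + (c - 1 - r)\<close>, so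
  \<open>s \<circ> t\<close> becomes \<open>c\<close> disjoint copies of the original permutation and the index is multiplied by \<open>c\<close>.\<close>

subsection \<open>Cycle counts of permutations\<close>

text \<open>For a permutation of \<open>A\<close> this counts cycles with fixed points included, so
  an isolated vertex of a meander contributes one.\<close>

definition ncyc :: "('a \<Rightarrow> 'a) \<Rightarrow> 'a set \<Rightarrow> nat" where
  "ncyc f A = card (orbit f ` A)"

lemma self_in_orbit:
  assumes "f permutes A" "finite A"
  shows "x \<in> orbit f x"
  using assms by (intro permutation_self_in_orbit) (auto simp: permutation_permutes)

lemma orbit_eq_if_mem:
  assumes "f permutes A" "finite A" "y \<in> orbit f x"
  shows "orbit f y = orbit f x"
  using cyclic_on_orbit[OF assms(1,2)] assms(3) by (rule orbit_cyclic_eq3)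

text \<open>An intertwining injection carries orbits onto orbits. It is applied to conjugation, to
  renumbering and to single residue classes.\<close>

lemma ncyc_image:
  assumes "f permutes A" "finite A" "inj_on h A" "\<And>x. x \<in> A \<Longrightarrow> g (h x) = h (f x)"
  shows "ncyc g (h ` A) = ncyc f A"
proof -
  have sub: "orbit f x \<subseteq> A" if "x \<in> A" for x
    using permutes_orbit_subset[OF assms(1) that] .
  have "h ` orbit f x = orbit g (h x)" if "x \<in> A" for x
    using self_in_orbit[OF assms(1,2)] assms(4) sub[OF that] by (intro orbit_inverse) auto
  then have "orbit g ` h ` A = image h ` (orbit f ` A)"
    by (simp add: image_image)
  moreover have "inj_on (image h) (orbit f ` A)"
    using assms(3) sub by (intro inj_onI) (auto simp: inj_on_image_eq_iff)
  ultimately show ?thesis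
    by (simp add: ncyc_def card_image)
qed

lemma ncyc_inverse:
  assumes "f permutes A" "finite A" "f \<circ> g = id" "g \<circ> f = id"
  shows "ncyc g A = ncyc f A"
proof -
  have "inv f = g"
    using assms(3,4) by (simp add: inv_unique_comp)
  then show ?thesis
    using orbit_inv_eq[OF permutes_imp_permutation[OF assms(2,1)]] by (simp add: ncyc_def)
qed

text \<open>\<open>g\<close> conjugates \<open>f \<circ> g\<close> to
  \<open>g \<circ> f\<close>.\<close>

lemma ncyc_comp_commute:
  assumes "f permutes A" "g permutes A" "finite A"
  shows "ncyc (g \<circ> f) A = ncyc (f \<circ> g) A"
  using ncyc_image[of "f \<circ> g" A g "g \<circ> f"] assms
  by (simp add: permutes_compose permutes_image permutes_inj_on)

lemma ncyc_Un:
  assumes "finite A" "finite B" "\<And>x. x \<in> A \<Longrightarrow> orbit f x \<subseteq> A" "\<And>x. x \<in> B \<Longrightarrow> orbit f x \<subseteq> B"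
    "A \<inter> B = {}"
  shows "ncyc f (A \<union> B) = ncyc f A + ncyc f B"
proof -
  have "orbit f ` A \<inter> orbit f ` B = {}"
    using assms(3-5) orbit_nonempty[of f] by blast
  then show ?thesis
    using assms(1,2) by (simp add: ncyc_def image_Un card_Un_disjoint)
qed

text \<open>\<open>f'\<close> is the first-return map on the points other than \<open>a\<close>: it
  cuts \<open>a\<close> out of its cycle, and a cycle vanishes exactly when \<open>a\<close> was
  fixed.\<close>

lemma ncyc_bypass:
  fixes f :: "'a \<Rightarrow> 'a"
  assumes f: "f permutes A" "finite A" and a: "a \<in> A"
  defines "f' \<equiv> \<lambda>x. if x = a then a else if f x = a then f a else f x"
  shows "f' permutes (A - {a})" (is ?perm)
    and "ncyc f A = of_bool (f a = a) + ncyc f' (A - {a})" (is ?card)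
proof -
  have inj: "f x = f y \<longleftrightarrow> x = y" for x y
    using permutes_inj[OF f(1)] by (auto simp: inj_def)
  \<comment> \<open>The preimage of \<open>a\<close> is redirected to \<open>f a\<close> and
    \<open>a\<close> becomes fixed, so \<open>f'\<close> is \<open>f\<close> followed by a (possibly
    trivial) transposition.\<close>
  have "f' = transpose a (f a) \<circ> f"
  proof
    fix y
    show "f' y = (transpose a (f a) \<circ> f) y"
      using inj[of y a] by (auto simp: f'_def transpose_def)
  qed
  moreover have "transpose a (f a) permutes A"
    using a f(1) by (intro permutes_swap_id) (auto simp: permutes_in_image)
  ultimately have "f' permutes A"
    using f(1) by (simp add: permutes_compose)
  then show ?perm
    by (rule permutes_superset) (auto simp: f'_def)
  have orb: "orbit f' x = orbit f x - {a}" if x: "x \<noteq> a" for x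
  proof (cases "f a = a")
    case True
    have "f' = f"
    proof
      fix y
      show "f' y = f y"
        using True inj[of y a] by (auto simp: f'_def)
    qed
    moreover have "a \<notin> orbit f x"
    proof
      assume "a \<in> orbit f x"
      then have "orbit f x = orbit f a"
        using f orbit_eq_if_mem by metis
      then show False
        using self_in_orbit[OF f, of x] x True by (simp add: orbit_eq_singleton_iff[THEN iffD2])
    qed
    ultimately show ?thesis by simp
  next
    case False
    have "y \<in> orbit f x - {a}" if "y \<in> orbit f' x" for y
      using that
    proof induction
      case base
      show ?case
        using x False orbit.base[of f x] orbit.step[of "f x" f x] by (auto simp: f'_def)
    next
      case (step y)
      then show ?case
        using False orbit.step[of y f x] orbit.step[of a f x] by (auto simp: f'_def)
    qed
    \<comment> \<open>When the \<open>f\<close>-orbit passes through \<open>a\<close>, the map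
      \<open>f'\<close> has already moved on to \<open>f a\<close>; the invariant records
      this.\<close>
    moreover have "(y \<noteq> a \<longrightarrow> y \<in> orbit f' x) \<and> (y = a \<longrightarrow> f a \<in> orbit f' x)"
      if "y \<in> orbit f x" for y
      using that
    proof induction
      case base
      show ?case
        using x orbit.base[of f' x] by (auto simp: f'_def split: if_splits)
    next
      case (step y)
      show ?case
      proof (cases "y = a")
        case True
        then show ?thesis using step False by auto
      next
        case False
        then show ?thesis
          using step orbit.step[of y f' x] by (auto simp: f'_def split: if_splits)
      qed
    qed
    ultimately show ?thesis by auto
  qed
  have img: "orbit f' ` (A - {a}) = (\<lambda>S. S - {a}) ` (orbit f ` (A - {a}))"
    unfolding image_image by (rule image_cong) (auto simp: orb)
  \<comment> \<open>Each orbit here contains a point other than \<open>a\<close>, which still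
    identifies it after \<open>a\<close> is deleted.\<close>
  have "inj_on (\<lambda>S. S - {a}) (orbit f ` (A - {a}))"
  proof (rule inj_onI)
    fix S S'
    assume "S \<in> orbit f ` (A - {a})" "S' \<in> orbit f ` (A - {a})" and eq: "S - {a} = S' - {a}"
    then obtain x y where xy: "x \<noteq> a" "S = orbit f x" "S' = orbit f y"
      by auto
    then have "x \<in> S'"
      using self_in_orbit[OF f, of x] eq by blast
    then show "S = S'"
      using orbit_eq_if_mem[OF f, of x y] xy by simp
  qed
  then have eq: "ncyc f' (A - {a}) = card (orbit f ` (A - {a}))"
    by (simp add: ncyc_def img card_image)
  have ins: "orbit f ` A = insert (orbit f a) (orbit f ` (A - {a}))"
    using a by blast
  show ?card
  proof (cases "f a = a")
    case True
    then have "orbit f a = {a}"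
      by (simp add: orbit_eq_singleton_iff)
    moreover have "{a} \<notin> orbit f ` (A - {a})"
      using self_in_orbit[OF f] by fastforce
    ultimately show ?thesis
      using f(2) True eq by (simp add: ncyc_def ins)
  next
    case False
    \<comment> \<open>The orbit of \<open>a\<close> is also that of \<open>f a\<close>, so it
      survives the deletion.\<close>
    have "orbit f a = orbit f (f a)"
      using f orbit_eq_if_mem orbit.base by metis
    moreover have "f a \<in> A - {a}"
      using False a f(1) by (simp add: permutes_in_image)
    ultimately have "orbit f a \<in> orbit f ` (A - {a})"
      by blast
    then show ?thesis
      using False eq by (simp add: ncyc_def ins insert_absorb)
  qed
qed

subsection \<open>First-return permutations on an interval\<close>

text \<open>Transport by a translation. With \<open>k\<close> a block length, the rest of a
  composition acts behind that block; with \<open>k = 1\<close>, vertices are counted from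
  1.\<close>

definition shift :: "nat \<Rightarrow> (nat \<Rightarrow> nat) \<Rightarrow> nat \<Rightarrow> nat" where
  "shift k f x = (if x < k then x else k + f (x - k))"

lemma shift_0 [simp]: "shift 0 f = f"
  by (simp add: shift_def fun_eq_iff)

lemma shift_shift: "shift k (shift l f) = shift (k + l) f"
  by (auto simp: shift_def fun_eq_iff)

lemma shift_comp: "shift k f \<circ> shift k g = shift k (f \<circ> g)"
  by (auto simp: shift_def fun_eq_iff)

lemma shift_id [simp]: "shift k id = id"
  by (auto simp: shift_def fun_eq_iff)

lemma shift_permutes:
  assumes "f permutes {..<n}"
  shows "shift k f permutes {..<k + n}"
proof -
  have inv: "f \<circ> inv f = id" "inv f \<circ> f = id"
    using permutes_inv_o[OF assms] by auto
  have "bij (shift k f)"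
    using inv by (intro o_bij[of "shift k (inv f)"]) (simp_all add: shift_comp)
  moreover have "shift k f x = x" if "x \<notin> {..<k + n}" for x
  proof -
    have "f (x - k) = x - k"
      using that by (intro permutes_not_in[OF assms]) auto
    then show ?thesis
      using that by (simp add: shift_def)
  qed
  ultimately show ?thesis
    by (simp add: permutes_def bij_iff)
qed

text \<open>The first-return map on the positive numbers, renumbered from 0.\<close>

definition skip :: "(nat \<Rightarrow> nat) \<Rightarrow> nat \<Rightarrow> nat" where
  "skip f x = (if f (Suc x) = 0 then f 0 - 1 else f (Suc x) - 1)"

lemma
  assumes f: "f permutes {..<Suc n}"
  shows skip_permutes: "skip f permutes {..<n}"
    and ncyc_skip: "ncyc f {..<Suc n} = of_bool (f 0 = 0) + ncyc (skip f) {..<n}"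
proof -
  define f' where "f' = (\<lambda>x. if x = 0 then 0 else if f x = 0 then f 0 else f x)"
  have eq: "{..<Suc n} - {0} = Suc ` {..<n}"
    by (simp only: lessThan_Suc_eq_insert_0) auto
  have perm: "f' permutes Suc ` {..<n}"
    using ncyc_bypass(1)[OF f, of 0] by (simp add: f'_def eq)
  have skip: "Suc (skip f x) = f' (Suc x)" for x
  proof -
    \<comment> \<open>As \<open>f' 0 = 0\<close>, injectivity keeps \<open>f' (Suc x)\<close>
      positive, so the truncated subtraction in \<open>skip\<close> is exact.\<close>
    have "f' (Suc x) \<noteq> f' 0"
      using permutes_inj[OF perm] by (metis injD nat.distinct(1))
    then show ?thesis
      by (auto simp: f'_def skip_def)
  qed
  show "skip f permutes {..<n}"
  proof (rule inj_imp_permutes)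
    show "inj_on (skip f) {..<n}"
    proof (rule inj_onI)
      fix x y
      assume "skip f x = skip f y"
      then have "f' (Suc x) = f' (Suc y)"
        by (simp flip: skip)
      then show "x = y"
        using injD[OF permutes_inj[OF perm]] by blast
    qed
    show "skip f x \<in> {..<n}" if "x \<in> {..<n}" for x
    proof -
      have "Suc (skip f x) \<in> Suc ` {..<n}"
        unfolding skip permutes_in_image[OF perm] using that by blast
      then show ?thesis by blast
    qed
    show "skip f x = x" if "x \<notin> {..<n}" for x
    proof -
      have "Suc (skip f x) = Suc x"
        unfolding skip using that by (intro permutes_not_in[OF perm]) auto
      then show ?thesis by simp
    qed
  qed simp
  then have "ncyc f' (Suc ` {..<n}) = ncyc (skip f) {..<n}"
    by (rule ncyc_image) (simp_all add: skip)
  then show "ncyc f {..<Suc n} = of_bool (f 0 = 0) + ncyc (skip f) {..<n}"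
    using ncyc_bypass(2)[OF f, of 0] by (simp add: f'_def eq)
qed

text \<open>\<open>shift (Suc k) g\<close> fixes 0 and preserves the positive numbers, so a detour
  through 0 comes from \<open>f\<close> alone.\<close>

lemma skip_comp_shift: "skip (f \<circ> shift (Suc k) g) = skip f \<circ> shift k g"
  by (auto simp: skip_def shift_def fun_eq_iff)

text \<open>The state of a left-to-right scan in which one side is \<open>d\<close> nodes ahead of the other is a list of
  length \<open>d\<close>: the first-return permutation induced on the \<open>d\<close> pending nodes. Dropping a node passes
  to the permutation induced on the remaining ones, and closes a cycle if the node is fixed.\<close>

definition lperm :: "nat list \<Rightarrow> nat \<Rightarrow> nat" where
  "lperm L x = (if x < length L then L ! x else x)"

definition invol :: "nat list \<Rightarrow> bool" where
  "invol L \<longleftrightarrow> (\<forall>x<length L. L ! x < length L \<and> L ! (L ! x) = x)"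

primrec drop_zero :: "nat list \<Rightarrow> nat list" where
  "drop_zero [] = []"
| "drop_zero (k # L) = map (\<lambda>y. if y = 0 then k - 1 else y - 1) L"

primrec trim :: "nat \<Rightarrow> nat list \<Rightarrow> nat list" where
  "trim 0 L = L"
| "trim (Suc j) L = trim j (drop_zero L)"

primrec closed_cycles :: "nat \<Rightarrow> nat list \<Rightarrow> nat" where
  "closed_cycles 0 L = 0"
| "closed_cycles (Suc j) L = of_bool (hd L = 0) + closed_cycles j (drop_zero L)"

text \<open>Block reversal on positions counted from 0. Its two-cycles are the arcs; its fixed
  points are the middles of odd blocks and everything beyond the last block.\<close>

fun flip :: "nat list \<Rightarrow> nat \<Rightarrow> nat" where
  "flip [] x = x"
| "flip (a # u) x = (if x < a then a - 1 - x else a + flip u (x - a))"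

lemma length_drop_zero [simp]: "length (drop_zero L) = length L - 1"
  by (cases L) auto

lemma length_trim [simp]: "length (trim j L) = length L - j"
  by (induction j arbitrary: L) auto

lemma flip_flip [simp]: "flip u (flip u x) = x"
  by (induction u x rule: flip.induct) auto

lemma flip_comp_flip [simp]: "flip u \<circ> flip u = id"
  by (simp add: fun_eq_iff)

lemma flip_outside: "sum_list u \<le> x \<Longrightarrow> flip u x = x"
  by (induction u arbitrary: x) auto

lemma permutes_if_involution:
  assumes "f \<circ> f = id" "\<And>x. x \<notin> A \<Longrightarrow> f x = x"
  shows "f permutes A"
  using involuntory_imp_bij[of f] assms by (auto simp: permutes_def bij_iff fun_eq_iff)

lemma flip_permutes: "sum_list u \<le> n \<Longrightarrow> flip u permutes {..<n}"
  by (rule permutes_if_involution) (auto simp: flip_outside)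

lemma flip_Cons: "flip (a # u) = flip [a] \<circ> shift a (flip u)"
  by (auto simp: fun_eq_iff shift_def)

lemma lperm_involution: "invol L \<Longrightarrow> lperm L \<circ> lperm L = id"
  by (auto simp: invol_def lperm_def fun_eq_iff)

lemma lperm_permutes: "invol L \<Longrightarrow> lperm L permutes {..<length L}"
  by (rule permutes_if_involution) (auto simp: lperm_involution, simp add: lperm_def)

lemma skip_lperm: "L \<noteq> [] \<Longrightarrow> skip (lperm L) = lperm (drop_zero L)"
  by (cases L) (auto simp: skip_def lperm_def fun_eq_iff)

text \<open>\<open>shift j f\<close> fixes the first \<open>j\<close> nodes, so they can be removed
  one at a time by changing the list alone. A node that is fixed when it is removed closes a
  cycle.\<close>

lemma ncyc_trim:
  assumes "lperm L permutes {..<length L}" "j \<le> length L" "length L \<le> n" "f permutes {..<n - j}"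
  shows "ncyc (lperm L \<circ> shift j f) {..<n} =
    closed_cycles j L + ncyc (lperm (trim j L) \<circ> f) {..<n - j}"
  using assms
proof (induction j arbitrary: L n)
  case 0
  then show ?case by simp
next
  case (Suc j)
  obtain m where n: "n = Suc m"
    using Suc.prems by (cases n) auto
  have L: "L \<noteq> []" "length L = Suc (length L - 1)"
    using Suc.prems by auto
  have "lperm L permutes {..<n}"
    using Suc.prems(1,3) by (auto intro: permutes_subset)
  moreover have "shift (Suc j) f permutes {..<n}"
    using shift_permutes[OF Suc.prems(4), of "Suc j"] Suc.prems(2,3) by simp
  ultimately have "lperm L \<circ> shift (Suc j) f permutes {..<Suc m}"
    by (simp add: permutes_compose n)
  then have "ncyc (lperm L \<circ> shift (Suc j) f) {..<Suc m} =
      of_bool ((lperm L \<circ> shift (Suc j) f) 0 = 0) + ncyc (skip (lperm L \<circ> shift (Suc j) f)) {..<m}"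
    by (rule ncyc_skip)
  also have "(lperm L \<circ> shift (Suc j) f) 0 = hd L"
    using L by (simp add: lperm_def shift_def hd_conv_nth)
  also have "skip (lperm L \<circ> shift (Suc j) f) = lperm (drop_zero L) \<circ> shift j f"
    by (simp add: skip_comp_shift skip_lperm L)
  also have "ncyc \<dots> {..<m} = closed_cycles j (drop_zero L)
      + ncyc (lperm (trim j (drop_zero L)) \<circ> f) {..<m - j}"
  proof (rule Suc.IH)
    have "lperm L permutes {..<Suc (length L - 1)}"
      using Suc.prems(1) L(2) by simp
    then show "lperm (drop_zero L) permutes {..<length (drop_zero L)}"
      using skip_permutes skip_lperm[OF L(1)] by (metis length_drop_zero)
  qed (use Suc.prems n in auto)
  finally show ?case
    by (simp add: n comp_def)
qed

text \<open>\<open>v\<close> holds the remaining blocks of the side that is behind, \<open>u\<close>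
  those of the side ahead, which resume \<open>length L\<close> nodes later. The value counts the
  cycles still to be closed.\<close>

definition cyc :: "nat list \<Rightarrow> nat list \<Rightarrow> nat list \<Rightarrow> nat" where
  "cyc L u v = ncyc (lperm L \<circ> shift (length L) (flip u) \<circ> flip v) {..<sum_list v}"

text \<open>A first block puts its side \<open>a\<close> nodes ahead, with the reversal of that
  block as pending permutation.\<close>

lemma cyc_Nil_Cons: "cyc [] (a # u) v = cyc (rev [0..<a]) u v"
proof -
  have "lperm [] \<circ> shift 0 (flip (a # u)) = lperm (rev [0..<a]) \<circ> shift a (flip u)"
    by (auto simp: fun_eq_iff lperm_def shift_def rev_nth)
  then show ?thesis
    by (simp add: cyc_def)
qed

text \<open>The new block lies within the pending nodes. It reverses the first \<open>a\<close>
  entries of the list; these nodes are then covered by both sides and can be trimmed.\<close>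

lemma cyc_Cons_short:
  assumes L: "invol L" and "a \<le> length L" and sum: "a + sum_list v = length L + sum_list u"
  defines "K \<equiv> rev (take a L) @ drop a L"
  shows "cyc L u (a # v) = closed_cycles a K + cyc (trim a K) u v"
proof -
  let ?d = "length L" and ?n = "a + sum_list v"
  have len: "length K = ?d"
    by (simp add: K_def)
  have K: "lperm K = lperm L \<circ> flip [a]"
    using assms(2) by (auto simp: fun_eq_iff lperm_def K_def nth_append rev_nth)
  have "flip [a] permutes {..<?d}"
    using assms(2) by (intro flip_permutes) simp
  then have K_perm: "lperm K permutes {..<length K}"
    unfolding K len using lperm_permutes[OF L] by (rule permutes_compose)
  \<comment> \<open>\<open>flip [a]\<close> moves only positions below \<open>a\<close>, while
    \<open>shift ?d (flip u)\<close> moves only positions from \<open>?d\<close> on, so the former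
    can be absorbed into \<open>lperm K\<close>.\<close>
  have "lperm L \<circ> shift ?d (flip u) \<circ> flip (a # v)
      = lperm K \<circ> shift a (shift (?d - a) (flip u) \<circ> flip v)"
  proof
    fix x
    show "(lperm L \<circ> shift ?d (flip u) \<circ> flip (a # v)) x
        = (lperm K \<circ> shift a (shift (?d - a) (flip u) \<circ> flip v)) x"
      using assms(2) by (auto simp: K shift_def add.commute)
  qed
  moreover have "ncyc (lperm K \<circ> shift a (shift (?d - a) (flip u) \<circ> flip v)) {..<?n} =
      closed_cycles a K + ncyc (lperm (trim a K) \<circ> (shift (?d - a) (flip u) \<circ> flip v)) {..<?n - a}"
  proof (rule ncyc_trim[OF K_perm])
    have "shift (?d - a) (flip u) permutes {..<?d - a + sum_list u}"
      by (intro shift_permutes flip_permutes) simp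
    moreover have "?d - a + sum_list u = ?n - a"
      using sum assms(2) by simp
    ultimately show "shift (?d - a) (flip u) \<circ> flip v permutes {..<?n - a}"
      by (intro permutes_compose flip_permutes) auto
  qed (use assms(2) sum len in auto)
  ultimately show ?thesis
    by (simp add: cyc_def len comp_assoc)
qed

text \<open>When the new block overtakes the pending one, the two sides exchange their roles; the
  permutation is replaced by a conjugate of its inverse, which has as many cycles.\<close>

lemma cyc_Cons_long:
  assumes L: "invol L" and "length L < a" and sum: "a + sum_list v = length L + sum_list u"
  defines "K \<equiv> rev (L @ [length L..<a])"
  shows "cyc L u (a # v) = closed_cycles (length L) K + cyc (trim (length L) K) v u"
proof -
  let ?d = "length L" and ?n = "a + sum_list v"
  define P S R T where "P = lperm L" and "S = shift ?d (flip u)" and "R = flip [a]"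
    and "T = shift a (flip v)"
  have len: "length K = a"
    using assms(2) by (simp add: K_def)
  \<comment> \<open>\<open>L\<close> is padded by fixed points up to length \<open>a\<close>;
    reversing the padded list composes it with the reversal of the new block.\<close>
  have K: "lperm K = P \<circ> R"
    using assms(2) by (auto simp: fun_eq_iff lperm_def K_def P_def R_def nth_append rev_nth)
  have sq: "P \<circ> P = id" "S \<circ> S = id" "R \<circ> R = id" "T \<circ> T = id"
    using lperm_involution[OF L] by (simp_all add: P_def S_def R_def T_def shift_comp)
  have R_a: "R permutes {..<a}" and P_a: "P permutes {..<a}"
    using assms(2) lperm_permutes[OF L] unfolding R_def P_def
    by (auto intro: flip_permutes permutes_subset)
  have perm: "P permutes {..<?n}" "S permutes {..<?n}" "R permutes {..<?n}" "T permutes {..<?n}"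
  proof -
    show "P permutes {..<?n}" "R permutes {..<?n}"
      using R_a P_a by (auto intro: permutes_subset)
    show "S permutes {..<?n}"
      unfolding S_def sum by (intro shift_permutes flip_permutes) simp
    show "T permutes {..<?n}"
      unfolding T_def by (intro shift_permutes flip_permutes) simp
  qed
  have K_perm: "lperm K permutes {..<length K}"
    unfolding K len using R_a P_a by (rule permutes_compose)
  have sq': "P (P x) = x" "S (S x) = x" "R (R x) = x" "T (T x) = x" for x
    using sq by (simp_all add: fun_eq_iff)
  have PR_a: "P \<circ> R permutes {..<a}"
    using R_a P_a by (rule permutes_compose)
  \<comment> \<open>\<open>T\<close> moves only positions from \<open>a\<close> on, and
    \<open>P \<circ> R\<close> only positions below \<open>a\<close>.\<close>
  have "T \<circ> (P \<circ> R) = (P \<circ> R) \<circ> T"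
  proof
    fix x
    show "(T \<circ> (P \<circ> R)) x = ((P \<circ> R) \<circ> T) x"
      using permutes_in_image[OF PR_a, of x] permutes_not_in[OF PR_a]
      by (auto simp: T_def shift_def)
  qed
  then have commute: "T ((P \<circ> R) x) = (P \<circ> R) (T x)" for x
    by (simp add: fun_eq_iff)
  have "T \<circ> P = P \<circ> T"
  proof
    fix x
    show "(T \<circ> P) x = (P \<circ> T) x"
      using permutes_in_image[OF P_a, of x] permutes_not_in[OF P_a]
      by (auto simp: T_def shift_def)
  qed
  then have commute': "T (P x) = P (T x)" for x
    by (simp add: fun_eq_iff)
  have "cyc L u (a # v) = ncyc (P \<circ> S \<circ> (R \<circ> T)) {..<?n}"
    by (simp only: cyc_def flip_Cons[of a v] P_def S_def R_def T_def sum_list.Cons)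
  \<comment> \<open>All four factors are involutions, so the inverse of the product is the product
    in reverse order.\<close>
  also have "\<dots> = ncyc (T \<circ> R \<circ> S \<circ> P) {..<?n}"
    using perm by (intro ncyc_inverse) (auto intro!: permutes_compose simp: fun_eq_iff sq')
  also have "\<dots> = ncyc (P \<circ> (T \<circ> R \<circ> S)) {..<?n}"
    using perm by (intro ncyc_comp_commute finite_lessThan permutes_compose)
  also have "P \<circ> (T \<circ> R \<circ> S) = (P \<circ> R) \<circ> (T \<circ> S)"
    using commute commute' by (simp add: fun_eq_iff)
  \<comment> \<open>Both tails start at or after \<open>?d\<close>. Relative to \<open>?d\<close>,
    the side of \<open>v\<close> is now ahead by \<open>a - ?d\<close> and the side of
    \<open>u\<close> is behind.\<close>
  also have "\<dots> = lperm K \<circ> shift ?d (shift (a - ?d) (flip v) \<circ> flip u)"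
    using assms(2) by (simp add: K T_def S_def shift_shift flip: shift_comp)
  also have "ncyc \<dots> {..<?n} = closed_cycles ?d K
      + ncyc (lperm (trim ?d K) \<circ> (shift (a - ?d) (flip v) \<circ> flip u)) {..<?n - ?d}"
  proof (rule ncyc_trim[OF K_perm])
    have "shift (a - ?d) (flip v) permutes {..<a - ?d + sum_list v}"
      by (intro shift_permutes flip_permutes) simp
    moreover have "a - ?d + sum_list v = ?n - ?d"
      using assms(2) by simp
    ultimately show "shift (a - ?d) (flip v) \<circ> flip u permutes {..<?n - ?d}"
      using sum by (intro permutes_compose flip_permutes) auto
  qed (use assms(2) len in auto)
  finally show ?thesis
    using sum by (simp add: cyc_def len comp_assoc)
qed

subsection \<open>The meander graph of two involutions\<close>

text \<open>Edges of a path are distinct because its vertices are. A cycle with two vertices has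
  parallel edges, so \<open>is_cycle_graphI\<close> asks for distinct edges separately.\<close>

lemma is_path_graphI:
  assumes v: "inj_on v {..<m}" "0 < m" and e: "\<And>i. i < m - 1 \<Longrightarrow> snd (e i) = {v i, v (Suc i)}"
  shows "is_path_graph (v ` {..<m}) (e ` {..<m - 1})"
proof -
  have "inj_on e {..<m - 1}"
  proof (rule inj_onI)
    fix i j
    assume ij: "i \<in> {..<m - 1}" "j \<in> {..<m - 1}" and "e i = e j"
    then have "{v i, v (Suc i)} = {v j, v (Suc j)}"
      using e by (metis lessThan_iff)
    then have "v i = v j \<or> v i = v (Suc j) \<and> v (Suc i) = v j"
      by (auto simp: doubleton_eq_iff)
    moreover have "i < m" "j < m" "Suc i < m" "Suc j < m"
      using ij by auto
    ultimately show "i = j"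
      using inj_onD[OF v(1), of i j] inj_onD[OF v(1), of i "Suc j"] inj_onD[OF v(1), of "Suc i" j]
      by force
  qed
  then show ?thesis
    unfolding is_path_graph_def using v e
    by (intro exI[of _ "map v [0..<m]"] exI[of _ "map e [0..<m - 1]"])
      (auto simp: distinct_map atLeast0LessThan)
qed

lemma is_cycle_graphI:
  assumes "inj_on v {..<n}" "0 < n" "inj_on e {..<n}"
    and "\<And>i. i < n \<Longrightarrow> snd (e i) = {v i, v (Suc i mod n)}"
  shows "is_cycle_graph (v ` {..<n}) (e ` {..<n})"
  unfolding is_cycle_graph_def using assms
  by (intro exI[of _ "map v [0..<n]"] exI[of _ "map e [0..<n]"])
    (auto simp: distinct_map atLeast0LessThan)

text \<open>A path has one vertex more than it has edges, a cycle equally many.\<close>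

lemma not_path_and_cycle: "is_path_graph C E \<Longrightarrow> \<not> is_cycle_graph C E"
  unfolding is_path_graph_def is_cycle_graph_def
  by (metis Suc_eq_plus1 distinct_card n_not_Suc_n)

text \<open>Abstract form of a meander: the two-cycles of \<open>s\<close> and \<open>t\<close> are
  the edges labelled \<open>l\<close> and \<open>m\<close>. Distinct labels keep parallel edges
  apart.\<close>

locale involution_pair =
  fixes V :: "'v set" and s t :: "'v \<Rightarrow> 'v" and l m :: 'l
  assumes finite_V: "finite V" and s_perm: "s permutes V" and t_perm: "t permutes V"
    and s_s [simp]: "s (s x) = x" and t_t [simp]: "t (t x) = x" and l_m: "l \<noteq> m"
begin

definition edges :: "('l \<times> 'v set) set" where
  "edges = {l} \<times> {{x, s x} | x. x \<in> V \<and> s x \<noteq> x} \<union> {m} \<times> {{x, t x} | x. x \<in> V \<and> t x \<noteq> x}"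

definition component :: "'v \<Rightarrow> 'v set" where
  "component x = (adjacency edges)\<^sup>* `` {x}"

definition p :: "'v \<Rightarrow> 'v" where
  "p x = s (t x)"

lemma p_eq_comp: "p = s \<circ> t"
  by (simp add: fun_eq_iff p_def)

lemma p_perm: "p permutes V"
  unfolding p_eq_comp using t_perm s_perm by (rule permutes_compose)

lemma s_in [simp]: "s x \<in> V \<longleftrightarrow> x \<in> V" and t_in [simp]: "t x \<in> V \<longleftrightarrow> x \<in> V"
  using s_perm t_perm by (simp_all add: permutes_in_image)

lemma self_in_p_orbit: "x \<in> orbit p x"
  using self_in_orbit[OF p_perm finite_V] .

lemma orbit_in_V: "x \<in> V \<Longrightarrow> y \<in> orbit p x \<Longrightarrow> y \<in> V"
  using permutes_orbit_subset[OF p_perm] by blast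

lemma adjacency_edges:
  "(x, y) \<in> adjacency edges \<longleftrightarrow> x \<in> V \<and> x \<noteq> y \<and> (y = s x \<or> y = t x)"
proof -
  have labels: "(\<exists>e\<in>{l} \<times> A \<union> {m} \<times> B. snd e = c) \<longleftrightarrow> c \<in> A \<or> c \<in> B" for A B :: "'v set set" and c
    by (auto intro: bexI[of _ "(l, c)"] bexI[of _ "(m, c)"])
  have "{x, y} \<in> {{z, s z} | z. z \<in> V \<and> s z \<noteq> z} \<longleftrightarrow> x \<in> V \<and> x \<noteq> y \<and> y = s x"
    "{x, y} \<in> {{z, t z} | z. z \<in> V \<and> t z \<noteq> z} \<longleftrightarrow> x \<in> V \<and> x \<noteq> y \<and> y = t x"
    by (auto simp: doubleton_eq_iff)
  then show ?thesis
    unfolding adjacency_def edges_def mem_Collect_eq case_prod_conv labels by blast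
qed

text \<open>\<open>t\<close> conjugates \<open>p\<close> to \<open>t \<circ> s\<close>, the inverse
  of \<open>p\<close>, which has the same orbits.\<close>

lemma image_t_orbit: "t ` orbit p x = orbit p (t x)"
proof -
  have "inv p = t \<circ> s"
    by (rule inv_unique_comp) (auto simp: fun_eq_iff p_def)
  moreover have "t ` orbit p x = orbit (t \<circ> s) (t x)"
    by (rule orbit_inverse[OF self_in_p_orbit]) (simp add: p_def)
  ultimately show ?thesis
    using orbit_inv_eq[OF permutes_imp_permutation[OF finite_V p_perm]] by metis
qed

text \<open>\<open>t (s y)\<close> is the \<open>p\<close>-predecessor of \<open>y\<close>, so
  \<open>s y\<close> is the \<open>t\<close>-image of a point of the same orbit.\<close>

lemma s_orbit:
  assumes "y \<in> orbit p x"
  shows "s y \<in> orbit p (t x)"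
proof -
  have "orbit p (t (s y)) = orbit p y"
    using permutation_orbit_step[OF permutes_imp_permutation[OF finite_V p_perm], of "t (s y)"] by (simp add: p_def)
  also have "\<dots> = orbit p x"
    using orbit_eq_if_mem[OF p_perm finite_V assms] .
  finally have "t (s y) \<in> orbit p x"
    using self_in_p_orbit by metis
  then show ?thesis
    using image_t_orbit[of x] by (metis image_eqI t_t)
qed

text \<open>Both \<open>s\<close> and \<open>t\<close> exchange the two orbits, so edges never leave
  their union. Conversely, one step of \<open>p\<close> follows at most two edges.\<close>

lemma component_eq:
  assumes "x \<in> V"
  shows "component x = orbit p x \<union> orbit p (t x)"
proof
  have "y \<in> orbit p x \<union> orbit p (t x)" if "(x, y) \<in> (adjacency edges)\<^sup>*" for y
    using that
  proof induction
    case base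
    show ?case using self_in_p_orbit by blast
  next
    case (step y z)
    then have "z = s y \<or> z = t y"
      by (simp add: adjacency_edges)
    moreover have "t ` orbit p (t x) = orbit p x"
      using image_t_orbit[of "t x"] by (simp only: t_t)
    moreover have "y \<in> orbit p (t x) \<Longrightarrow> s y \<in> orbit p x"
      using s_orbit[of y "t x"] by (simp only: t_t)
    ultimately show ?case
      using step.IH s_orbit[of y x] image_t_orbit[of x] by blast
  qed
  then show "component x \<subseteq> orbit p x \<union> orbit p (t x)"
    by (auto simp: component_def)
next
  have step_s: "s y \<in> component x" and step_t: "t y \<in> component x" if "y \<in> component x" "y \<in> V" for y
  proof -
    have "s y = y \<or> (y, s y) \<in> adjacency edges" "t y = y \<or> (y, t y) \<in> adjacency edges"
      using that by (auto simp: adjacency_edges)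
    then show "s y \<in> component x" "t y \<in> component x"
      using that by (auto simp: component_def intro: rtrancl_into_rtrancl)
  qed
  have orb: "y \<in> component x" if "y \<in> orbit p z" "z \<in> component x" "z \<in> V" for y z
    using that
  proof induction
    case base
    then show ?case by (simp add: step_s step_t p_def)
  next
    case (step y)
    then show ?case
      using orbit_in_V[of y z] orbit_in_V[of z y] by (simp add: step_s step_t p_def)
  qed
  have "x \<in> component x"
    by (simp add: component_def)
  then show "orbit p x \<union> orbit p (t x) \<subseteq> component x"
    using orb assms step_t by auto
qed

lemma component_eqI:
  assumes "x \<in> V" "y \<in> component x"
  shows "component y = component x" "y \<in> V"
proof -
  have "sym (adjacency edges)"
    by (auto simp: sym_def adjacency_edges)
  then have "equiv UNIV ((adjacency edges)\<^sup>*)"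
    by (simp add: equiv_def refl_rtrancl sym_rtrancl trans_rtrancl)
  then show "component y = component x"
    using assms(2) by (simp add: component_def equiv_class_eq_iff)
  show "y \<in> V"
    using assms component_eq orbit_in_V t_in by (metis Un_iff)
qed

lemma edges_within_component:
  assumes "x \<in> V"
  shows "edges_within edges (component x) =
    {l} \<times> {{y, s y} | y. y \<in> component x \<and> s y \<noteq> y} \<union> {m} \<times> {{y, t y} | y. y \<in> component x \<and> t y \<noteq> y}"
proof -
  have "s y \<in> component x" "t y \<in> component x" if y: "y \<in> component x" for y
  proof -
    have "y \<in> V" "component y = component x"
      using component_eqI[OF assms y] by auto
    then show "s y \<in> component x" "t y \<in> component x"
      using s_orbit[OF self_in_p_orbit, of y] self_in_p_orbit[of "t y"] component_eq[of y] by auto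
  qed
  then show ?thesis
    using component_eqI(2)[OF assms] by (auto simp: edges_within_def edges_def)
qed

text \<open>A dihedral relation: \<open>t\<close> conjugates \<open>p\<close> to its
  inverse.\<close>

lemma funpow_t: "(p ^^ n) (t ((p ^^ n) x)) = t x"
proof (induction n)
  case 0
  show ?case by simp
next
  case (Suc n)
  have "(p ^^ Suc n) (t ((p ^^ Suc n) x))
      = (p ^^ n) (p (t (p ((p ^^ n) x))))"
    by (simp add: funpow_swap1)
  also have "\<dots> = (p ^^ n) (t ((p ^^ n) x))"
    by (simp add: p_def)
  finally show ?case
    using Suc.IH by simp
qed

lemma inj_funpow: "(p ^^ n) x = (p ^^ n) y \<longleftrightarrow> x = y"
  using inj_fn[OF permutes_inj[OF p_perm]] by (simp add: inj_eq)

text \<open>If \<open>t x\<close> is \<open>n\<close> steps of \<open>p\<close> after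
  \<open>x\<close>, the reflection \<open>t\<close> has its axis halfway. For even \<open>n\<close>
  the midpoint \<open>z\<close> is fixed by \<open>t\<close>; for odd \<open>n\<close>,
  \<open>t z = p z = s (t z)\<close>, so \<open>t z\<close> is fixed by \<open>s\<close>.\<close>

lemma fixed_point_if_one_orbit:
  assumes "x \<in> V" "orbit p (t x) = orbit p x"
  obtains w where "w \<in> component x" "s w = w \<or> t w = w"
proof -
  have "t x \<in> orbit p x"
    using assms(2) self_in_p_orbit by metis
  then obtain n where n: "t x = (p ^^ n) x"
    by (auto simp: orbit_altdef)
  define k where "k = n div 2"
  define z where "z = (p ^^ k) x"
  have z: "z \<in> orbit p x"
    unfolding z_def using self_in_p_orbit by (rule funpow_in_orbit)
  then have "z \<in> component x" "t z \<in> component x"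
    using component_eq[OF assms(1)] image_t_orbit[of x] by auto
  moreover have "s (t z) = t z \<or> t z = z"
  proof (cases "even n")
    case True
    then have "n = k + k"
      by (auto simp: k_def)
    then have "(p ^^ k) (t z) = (p ^^ k) z"
      using funpow_t[of k x] n by (simp add: z_def funpow_add)
    then show ?thesis
      by (simp add: inj_funpow)
  next
    case False
    then have "n = k + Suc k"
      by (auto simp: k_def elim!: oddE)
    then have "(p ^^ k) (t z) = (p ^^ k) (p z)"
      using funpow_t[of k x] n by (simp only: z_def funpow_add) simp
    then have "t z = p z"
      by (simp only: inj_funpow)
    then show ?thesis by (simp add: p_def)
  qed
  ultimately show ?thesis
    using that by blast
qed

lemma orbit_enum:
  obtains n where "0 < n" "(p ^^ n) x = x" "inj_on (\<lambda>k. (p ^^ k) x) {..<n}"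
    "orbit p x = (\<lambda>k. (p ^^ k) x) ` {..<n}"
  using that[of "funpow_dist1 p x x"] funpow_dist1_prop[OF self_in_p_orbit, of x]
    inj_on_funpow_dist1[OF self_in_p_orbit, of x] orbit_conv_funpow_dist1[OF self_in_p_orbit, of x]
  unfolding atLeast0LessThan by blast

text \<open>Such a \<open>w\<close> is an end of a path. Applying \<open>s\<close> and
  \<open>t\<close> alternately from it visits the whole orbit once and stops at another end, or at
  \<open>w\<close> itself if it is isolated.\<close>

lemma path_if_t_fixed:
  assumes w: "w \<in> V" "t w = w"
  shows "is_path_graph (component w) (edges_within edges (component w))"
proof -
  obtain n where n: "0 < n" "(p ^^ n) w = w" and inj: "inj_on (\<lambda>k. (p ^^ k) w) {..<n}"
    and orb: "orbit p w = (\<lambda>k. (p ^^ k) w) ` {..<n}"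
    using orbit_enum by blast
  define v where "v = rec_nat w (\<lambda>i. if even i then s else t)"
  have v0: "v 0 = w" and vs: "even i \<Longrightarrow> v (Suc i) = s (v i)" and vt: "odd i \<Longrightarrow> v (Suc i) = t (v i)" for i
    by (simp_all add: v_def)
  have v_odd: "v (Suc (2 * j)) = (p ^^ Suc j) w" for j
  proof (induction j)
    case 0
    show ?case using vs[of 0] v0 w by (simp add: p_def)
  next
    case (Suc j)
    then show ?case
      using vs[of "Suc (Suc (2 * j))"] vt[of "Suc (2 * j)"] by (simp add: p_def)
  qed
  have v_even': "(p ^^ j) (v (2 * j)) = w" for j
  proof (induction j)
    case 0
    show ?case using v0 by simp
  next
    case (Suc j)
    then show ?case
      using vs[of "2 * j"] vt[of "Suc (2 * j)"] p_def[of "t (s (v (2 * j)))"] by (simp add: funpow_swap1)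
  qed
  have v_even: "v (2 * j) = (p ^^ (n - j)) w" if "j \<le> n" for j
  proof -
    have "(p ^^ j) ((p ^^ (n - j)) w) = (p ^^ (j + (n - j))) w"
      by (simp only: funpow_add comp_apply)
    then have "(p ^^ j) ((p ^^ (n - j)) w) = (p ^^ j) (v (2 * j))"
      using that n v_even'[of j] by simp
    then show ?thesis
      by (simp only: inj_funpow)
  qed
  \<comment> \<open>The exponent of \<open>p\<close> reached at step \<open>i\<close>: odd steps run
    forward along the orbit, even steps backward. Step 0 gets exponent 0 instead of
    \<open>n\<close>, to stay below \<open>n\<close>.\<close>
  define ex where "ex i = (if i = 0 then 0 else if even i then n - i div 2 else Suc (i div 2))" for i
  have v_ex: "v i = (p ^^ ex i) w" if "i < n" for i
    using that v_odd[of "i div 2"] v_even[of "i div 2"] v0 by (cases "even i") (auto simp: ex_def)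
  have ex_less: "ex i < n" if "i < n" for i
    using that by (auto simp: ex_def elim!: evenE oddE)
  have ex_inj: "i = j" if "i < n" "j < n" "ex i = ex j" for i j
    using that by (auto simp: ex_def elim!: evenE oddE split: if_splits)
  have v_inj: "inj_on v {..<n}"
  proof (rule inj_onI)
    fix i j
    assume ij: "i \<in> {..<n}" "j \<in> {..<n}" "v i = v j"
    then have "ex i = ex j"
      using v_ex ex_less inj_onD[OF inj, of "ex i" "ex j"] by auto
    then show "i = j"
      using ex_inj ij by auto
  qed
  have "component w = orbit p w"
    using component_eq[OF w(1)] w(2) by simp
  moreover have "v ` {..<n} = orbit p w"
  proof (rule card_subset_eq)
    show "finite (orbit p w)"
      by (simp add: orb)
    show "v ` {..<n} \<subseteq> orbit p w"
      using v_ex ex_less by (auto simp: orb)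
    show "card (v ` {..<n}) = card (orbit p w)"
      using v_inj inj by (simp add: orb card_image)
  qed
  ultimately have comp: "component w = v ` {..<n}"
    by simp
  \<comment> \<open>The next involution fixes the last vertex, so no edge continues the
    walk.\<close>
  have v_end: "v n = v (n - 1)"
  proof (cases "even n")
    case True
    then obtain j where j: "n = 2 * j" by blast
    then obtain i where "j = Suc i"
      using n(1) by (cases j) auto
    then show ?thesis
      using v_even[of j] v_odd[of i] j by simp
  next
    case False
    then obtain j where "n = Suc (2 * j)" by (auto elim!: oddE)
    then show ?thesis
      using v_even[of j] v_odd[of j] by simp
  qed
  define e where "e i = (if even i then l else m, {v i, v (Suc i)})" for i
  have "e ` {..<n - 1} = edges_within edges (component w)"
    unfolding edges_within_component[OF w(1)] unfolding comp
  proof (intro equalityI subsetI)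
    fix a
    assume "a \<in> e ` {..<n - 1}"
    then obtain i where i: "i < n - 1" "a = e i" by auto
    then have "Suc i < n" by simp
    then have "v i \<noteq> v (Suc i)" "v i \<in> v ` {..<n}"
      using inj_onD[OF v_inj, of i "Suc i"] by auto
    then show "a \<in> {l} \<times> {{y, s y} | y. y \<in> v ` {..<n} \<and> s y \<noteq> y} \<union>
        {m} \<times> {{y, t y} | y. y \<in> v ` {..<n} \<and> t y \<noteq> y}"
      using i vs[of i] vt[of i] by (cases "even i") (auto simp: e_def)
  next
    fix a
    assume "a \<in> {l} \<times> {{y, s y} | y. y \<in> v ` {..<n} \<and> s y \<noteq> y} \<union>
        {m} \<times> {{y, t y} | y. y \<in> v ` {..<n} \<and> t y \<noteq> y}"
    then consider i where "i < n" "a = (l, {v i, s (v i)})" "s (v i) \<noteq> v i"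
      | i where "i < n" "a = (m, {v i, t (v i)})" "t (v i) \<noteq> v i"
      by auto
    then show "a \<in> e ` {..<n - 1}"
    proof cases
      case (1 i)
      show ?thesis
      proof (cases "even i")
        case True
        then have "Suc i \<noteq> n"
          using 1 vs[of i] v_end by auto
        then show ?thesis
          using 1 True vs[of i] by (intro image_eqI[of _ _ i]) (auto simp: e_def)
      next
        case False
        then obtain j where "i = Suc j"
          by (cases i) auto
        then show ?thesis
          using 1 False vs[of j] by (intro image_eqI[of _ _ j]) (auto simp: e_def)
      qed
    next
      case (2 i)
      show ?thesis
      proof (cases "even i")
        case True
        then obtain j where "i = Suc j"
          using 2 v0 w by (cases i) auto
        then show ?thesis
          using 2 True vt[of j] by (intro image_eqI[of _ _ j]) (auto simp: e_def)
      next
        case False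
        then have "Suc i \<noteq> n"
          using 2 vt[of i] v_end by auto
        then show ?thesis
          using 2 False vt[of i] by (intro image_eqI[of _ _ i]) (auto simp: e_def)
      qed
    qed
  qed
  then show ?thesis
    unfolding comp using is_path_graphI[OF v_inj n(1), of e] by (simp add: e_def)
qed

text \<open>The walk \<open>w\<close>, \<open>t w\<close>, \<open>p w\<close>,
  \<open>t (p w)\<close>, ... alternates between two disjoint orbits of size \<open>n\<close> and
  closes after \<open>2 * n\<close> steps, since \<open>p ^^ n\<close> fixes
  \<open>w\<close>.\<close>

lemma cycle_if_two_orbits:
  assumes w: "w \<in> V" and "orbit p (t w) \<noteq> orbit p w"
  shows "is_cycle_graph (component w) (edges_within edges (component w))"
proof -
  obtain n where n: "0 < n" "(p ^^ n) w = w" and inj: "inj_on (\<lambda>k. (p ^^ k) w) {..<n}"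
    and orb: "orbit p w = (\<lambda>k. (p ^^ k) w) ` {..<n}"
    using orbit_enum by blast
  define v where "v i = (if even i then (p ^^ (i div 2)) w else t ((p ^^ (i div 2)) w))" for i
  have orb_t: "orbit p (t w) = (\<lambda>k. t ((p ^^ k) w)) ` {..<n}"
    by (simp only: image_t_orbit[symmetric] orb image_image)
  have disj: "orbit p w \<inter> orbit p (t w) = {}"
    using assms(2) orbit_eq_if_mem[OF p_perm finite_V] by blast
  have v_in: "v i \<in> (if even i then orbit p w else orbit p (t w))" if "i < 2 * n" for i
    using that by (auto simp: v_def orb orb_t)
  have v_inj: "inj_on v {..<2 * n}"
  proof (rule inj_onI)
    fix i j
    assume ij: "i \<in> {..<2 * n}" "j \<in> {..<2 * n}" and eq: "v i = v j"
    have par: "even i \<longleftrightarrow> even j"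
      using v_in[of i] v_in[of j] ij eq disj by (auto split: if_splits)
    moreover have "(p ^^ (i div 2)) w = (p ^^ (j div 2)) w"
      using eq par by (auto simp: v_def split: if_splits) (metis t_t)
    then have "i div 2 = j div 2"
      using inj_onD[OF inj, of "i div 2" "j div 2"] ij by auto
    ultimately show "i = j"
      by (metis even_two_times_div_two odd_two_times_div_two_succ)
  qed
  have "v ` {..<2 * n} = component w"
  proof
    show "v ` {..<2 * n} \<subseteq> component w"
      using v_in by (fastforce simp: component_eq[OF w] split: if_splits)
    have "(p ^^ k) w \<in> v ` {..<2 * n}" "t ((p ^^ k) w) \<in> v ` {..<2 * n}" if "k < n" for k
      using that image_eqI[of _ v "2 * k" "{..<2 * n}"] image_eqI[of _ v "Suc (2 * k)" "{..<2 * n}"]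
      by (auto simp: v_def)
    then show "component w \<subseteq> v ` {..<2 * n}"
      unfolding component_eq[OF w] orb orb_t by auto
  qed
  then have comp: "component w = v ` {..<2 * n}"
    by simp
  have vt: "v (Suc i mod (2 * n)) = t (v i)" if "even i" "i < 2 * n" for i
  proof -
    have "Suc i < 2 * n"
      using that by presburger
    then show ?thesis
      using that by (simp add: v_def)
  qed
  have vs: "v (Suc i mod (2 * n)) = s (v i)" if "odd i" "i < 2 * n" for i
  proof (cases "Suc i = 2 * n")
    case True
    then have "n = Suc (i div 2)"
      by presburger
    then have "s (t ((p ^^ (i div 2)) w)) = w"
      using n(2) by (simp add: p_def)
    then show ?thesis
      using True that by (simp add: v_def)
  next
    case False
    then have "Suc i < 2 * n"
      using that by simp
    then show ?thesis
      using that by (simp add: v_def p_def)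
  qed
  have parity: "even (Suc i mod (2 * n)) \<longleftrightarrow> odd i" for i
    by (simp add: dvd_mod_iff)
  define e where "e i = (if even i then m else l, {v i, v (Suc i mod (2 * n))})" for i
  \<comment> \<open>The label determines the parity of the index. This separates edges with the same
    ends, including the two parallel edges when \<open>n = 1\<close>.\<close>
  have e_inj: "inj_on e {..<2 * n}"
  proof (rule inj_onI)
    fix i j
    assume ij: "i \<in> {..<2 * n}" "j \<in> {..<2 * n}" and "e i = e j"
    then have par: "even i \<longleftrightarrow> even j" and "v i = v j \<or> v i = v (Suc j mod (2 * n))"
      using l_m by (auto simp: e_def doubleton_eq_iff split: if_splits)
    then have "i = j \<or> i = Suc j mod (2 * n)"
      using inj_onD[OF v_inj, of i j] inj_onD[OF v_inj, of i "Suc j mod (2 * n)"] ij n(1) by auto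
    then show "i = j"
      using par parity by auto
  qed
  have "e ` {..<2 * n} = edges_within edges (component w)"
    unfolding edges_within_component[OF w] unfolding comp
  proof (intro equalityI subsetI)
    fix a
    assume "a \<in> e ` {..<2 * n}"
    then obtain i where i: "i < 2 * n" "a = e i" by auto
    then have "v i \<noteq> v (Suc i mod (2 * n))" "v i \<in> v ` {..<2 * n}"
      using inj_onD[OF v_inj, of i "Suc i mod (2 * n)"] parity[of i] n(1) by auto
    then show "a \<in> {l} \<times> {{y, s y} | y. y \<in> v ` {..<2 * n} \<and> s y \<noteq> y} \<union>
        {m} \<times> {{y, t y} | y. y \<in> v ` {..<2 * n} \<and> t y \<noteq> y}"
      using i vs[of i] vt[of i] by (cases "even i") (auto simp: e_def)
  next
    \<comment> \<open>An edge is indexed by its first end in the walk; seen from its second end, it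
      belongs to the preceding index.\<close>
    have pred: "\<exists>j<2 * n. i = Suc j mod (2 * n)" if "i < 2 * n" for i
      using that n(1) by (intro exI[of _ "if i = 0 then 2 * n - 1 else i - 1"]) auto
    fix a
    assume "a \<in> {l} \<times> {{y, s y} | y. y \<in> v ` {..<2 * n} \<and> s y \<noteq> y} \<union>
        {m} \<times> {{y, t y} | y. y \<in> v ` {..<2 * n} \<and> t y \<noteq> y}"
    then consider i where "i < 2 * n" "a = (l, {v i, s (v i)})"
      | i where "i < 2 * n" "a = (m, {v i, t (v i)})"
      by auto
    then show "a \<in> e ` {..<2 * n}"
    proof cases
      case (1 i)
      obtain j where j: "j < 2 * n" "i = Suc j mod (2 * n)"
        using pred[OF 1(1)] by blast
      show ?thesis
      proof (cases "odd i")
        case True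
        then show ?thesis
          using 1 vs[of i] by (intro image_eqI[of _ _ i]) (auto simp: e_def)
      next
        case False
        then have "odd j"
          using j parity[of j] by simp
        then show ?thesis
          using 1 j vs[of j] by (intro image_eqI[of _ _ j]) (auto simp: e_def)
      qed
    next
      case (2 i)
      obtain j where j: "j < 2 * n" "i = Suc j mod (2 * n)"
        using pred[OF 2(1)] by blast
      show ?thesis
      proof (cases "even i")
        case True
        then show ?thesis
          using 2 vt[of i] by (intro image_eqI[of _ _ i]) (auto simp: e_def)
      next
        case False
        then have "even j"
          using j parity[of j] by simp
        then show ?thesis
          using 2 j vt[of j] by (intro image_eqI[of _ _ j]) (auto simp: e_def)
      qed
    qed
  qed
  then show ?thesis
    unfolding comp using is_cycle_graphI[OF v_inj _ e_inj] n(1) by (simp add: e_def)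
qed

lemma component_cases:
  assumes "x \<in> V"
  shows "is_path_graph (component x) (edges_within edges (component x)) \<and> orbit p (t x) = orbit p x
    \<or> is_cycle_graph (component x) (edges_within edges (component x)) \<and> orbit p (t x) \<noteq> orbit p x"
proof (cases "orbit p (t x) = orbit p x")
  case True
  then obtain w where w: "w \<in> component x" "s w = w \<or> t w = w"
    using fixed_point_if_one_orbit assms by blast
  have eq: "component w = component x" and "w \<in> V"
    using component_eqI[OF assms w(1)] by auto
  \<comment> \<open>The fixed point may belong to \<open>s\<close>; exchanging the involutions
    together with their labels leaves the edge set unchanged.\<close>
  interpret swap: involution_pair V t s m l
    using finite_V s_perm t_perm l_m by unfold_locales auto
  have "swap.edges = edges"
    by (auto simp: edges_def swap.edges_def)
  then have "swap.component = component"
    by (simp add: fun_eq_iff component_def swap.component_def)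
  then have "is_path_graph (component w) (edges_within edges (component w))"
    using w(2) \<open>w \<in> V\<close> path_if_t_fixed swap.path_if_t_fixed \<open>swap.edges = edges\<close> by metis
  then show ?thesis
    using True eq by simp
next
  case False
  then show ?thesis
    using cycle_if_two_orbits assms by blast
qed

text \<open>The map sending an orbit \<open>S\<close> to its union with its \<open>t\<close>-image
  has the components as values. Its fibre has one element over a path and two over a cycle, so the
  weighted count of components is the number of orbits.\<close>

theorem index_eq_ncyc: "2 * num_cycles V edges + num_paths V edges = ncyc (s \<circ> t) V"
proof -
  define \<C> where "\<C> = component ` V"
  define path where "path C \<longleftrightarrow> is_path_graph C (edges_within edges C)" for C
  have comps: "components V edges = \<C>"
    by (auto simp: components_def quotient_def \<C>_def component_def)
  have fin: "finite \<C>"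
    by (simp add: \<C>_def finite_V)
  have "is_cycle_graph C (edges_within edges C) \<longleftrightarrow> \<not> path C" if C: "C \<in> \<C>" for C
  proof -
    obtain x where "x \<in> V" "C = component x"
      using C by (auto simp: \<C>_def)
    then show ?thesis
      using component_cases[of x] not_path_and_cycle by (auto simp: path_def)
  qed
  then have "2 * num_cycles V edges + num_paths V edges
      = 2 * card {C \<in> \<C>. \<not> path C} + card {C \<in> \<C>. path C}"
    by (simp add: num_cycles_def num_paths_def comps path_def cong: conj_cong)
  also have "\<dots> = (\<Sum>C\<in>\<C>. if path C then 1 else 2)"
    using fin by (simp add: sum.If_cases Int_def)
  also have "\<dots> = (\<Sum>C\<in>\<C>. card {S \<in> orbit p ` V. S \<union> t ` S = C})"
  proof (rule sum.cong[OF refl])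
    fix C
    assume "C \<in> \<C>"
    then obtain x where x: "x \<in> V" "C = component x"
      by (auto simp: \<C>_def)
    have "{S \<in> orbit p ` V. S \<union> t ` S = C} = {orbit p x, orbit p (t x)}"
    proof (intro equalityI subsetI)
      fix S
      assume "S \<in> {S \<in> orbit p ` V. S \<union> t ` S = C}"
      then obtain y where y: "S = orbit p y" "y \<in> C"
        using self_in_p_orbit by blast
      then have "y \<in> orbit p x \<or> y \<in> orbit p (t x)"
        using component_eq[OF x(1)] x(2) by blast
      then show "S \<in> {orbit p x, orbit p (t x)}"
        using orbit_eq_if_mem[OF p_perm finite_V] y by blast
    next
      fix S
      assume "S \<in> {orbit p x, orbit p (t x)}"
      moreover have "t ` orbit p (t x) = orbit p x"
        using image_t_orbit[of "t x"] by (simp only: t_t)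
      ultimately show "S \<in> {S \<in> orbit p ` V. S \<union> t ` S = C}"
        using x component_eq[OF x(1)] image_t_orbit[of x] by auto
    qed
    moreover have "path C \<longleftrightarrow> orbit p (t x) = orbit p x"
      using component_cases[OF x(1)] not_path_and_cycle x(2) by (auto simp: path_def)
    ultimately show "(if path C then 1 else 2) = card {S \<in> orbit p ` V. S \<union> t ` S = C}"
      by (auto simp: card_insert_if)
  qed
  also have "\<dots> = card (orbit p ` V)"
  proof -
    have "\<C> = (\<lambda>S. S \<union> t ` S) ` (orbit p ` V)"
      unfolding \<C>_def image_image by (rule image_cong) (simp_all add: component_eq image_t_orbit)
    then show ?thesis
      using sum.image_gen[of "orbit p ` V" "\<lambda>_. 1 :: nat" "\<lambda>S. S \<union> t ` S"] finite_V by simp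
  qed
  finally show ?thesis
    by (simp add: ncyc_def p_eq_comp)
qed

end

section \<open>Arcs of a composition as two-cycles of its block reversal\<close>

lemma arcs_Nil: "arcs [] = {}"
  by (simp add: arcs_def)

lemma arcs_Cons: "arcs (a # u) = {{i, a + 1 - i} | i. 1 \<le> i \<and> i \<le> a div 2} \<union> image ((+) a) ` arcs u"
proof -
  have "arcs (a # u) = {{i, a + 1 - i} | i. 1 \<le> i \<and> i \<le> a div 2} \<union>
      {{a + sum_list (take j u) + i, a + sum_list (take j u) + u ! j + 1 - i} | j i.
        j < length u \<and> 1 \<le> i \<and> i \<le> u ! j div 2}" (is "_ = ?A \<union> ?B")
  proof (intro equalityI subsetI)
    fix S
    assume "S \<in> arcs (a # u)"
    then obtain j i where "j < length (a # u)" "1 \<le> i" "i \<le> (a # u) ! j div 2"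
      "S = {sum_list (take j (a # u)) + i, sum_list (take j (a # u)) + (a # u) ! j + 1 - i}"
      by (auto simp: arcs_def)
    then show "S \<in> ?A \<union> ?B"
      by (cases j) auto
  next
    fix S
    assume "S \<in> ?A \<union> ?B"
    then show "S \<in> arcs (a # u)"
    proof
      assume "S \<in> ?A"
      then obtain i where "1 \<le> i" "i \<le> a div 2" "S = {i, a + 1 - i}"
        by blast
      then show ?thesis
        unfolding arcs_def by (intro CollectI exI[of _ 0] exI[of _ i]) simp
    next
      assume "S \<in> ?B"
      then obtain j i where "j < length u" "1 \<le> i" "i \<le> u ! j div 2"
        "S = {a + sum_list (take j u) + i, a + sum_list (take j u) + u ! j + 1 - i}"
        by auto
      then show ?thesis
        unfolding arcs_def by (intro CollectI exI[of _ "Suc j"] exI[of _ i]) simp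
    qed
  qed
  also have "?B = image ((+) a) ` arcs u"
  proof -
    have shift: "{a + p + i, a + p + b + 1 - i} = (+) a ` {p + i, p + b + 1 - i}" if "i \<le> b div 2" for p b i :: nat
      using that by auto
    show ?thesis
    proof (intro equalityI subsetI)
      fix S
      assume "S \<in> ?B"
      then show "S \<in> image ((+) a) ` arcs u"
        unfolding arcs_def using shift by blast
    next
      fix S
      assume "S \<in> image ((+) a) ` arcs u"
      then show "S \<in> ?B"
        unfolding arcs_def using shift by blast
    qed
  qed
  finally show ?thesis .
qed

lemma arcs_eq:
  "arcs u = {{y, shift 1 (flip u) y} | y. y \<in> {1..sum_list u} \<and> shift 1 (flip u) y \<noteq> y}"
proof (induction u)
  case Nil
  show ?case by (simp add: arcs_Nil)
next
  case (Cons a u)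
  let ?f = "shift 1 (flip u)" and ?g = "shift 1 (flip (a # u))"
  have low: "?g y = a + 1 - y" if "1 \<le> y" "y \<le> a" for y
    using that by (auto simp: shift_def)
  have high: "?g (a + y) = a + ?f y" if "1 \<le> y" for y
    using that by (auto simp: shift_def)
  have "{{y, ?g y} | y. y \<in> {1..a} \<and> ?g y \<noteq> y} = {{i, a + 1 - i} | i. 1 \<le> i \<and> i \<le> a div 2}"
  proof (intro equalityI subsetI)
    fix S
    assume "S \<in> {{y, ?g y} | y. y \<in> {1..a} \<and> ?g y \<noteq> y}"
    then obtain y where y: "1 \<le> y" "y \<le> a" "a + 1 - y \<noteq> y" "S = {y, a + 1 - y}"
      using low by auto
    show "S \<in> {{i, a + 1 - i} | i. 1 \<le> i \<and> i \<le> a div 2}"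
    proof (cases "y \<le> a div 2")
      case True
      then show ?thesis using y by auto
    next
      case False
      \<comment> \<open>A vertex in the right half of the block gives the arc already listed from
        its left end.\<close>
      then have "1 \<le> a + 1 - y \<and> a + 1 - y \<le> a div 2" "S = {a + 1 - y, a + 1 - (a + 1 - y)}"
        using y by auto
      then show ?thesis by blast
    qed
  next
    fix S
    assume "S \<in> {{i, a + 1 - i} | i. 1 \<le> i \<and> i \<le> a div 2}"
    then obtain y where y: "1 \<le> y" "y \<le> a div 2" "S = {y, a + 1 - y}"
      by auto
    then have "y \<in> {1..a}" "?g y \<noteq> y" "S = {y, ?g y}"
      using low[of y] by auto
    then show "S \<in> {{y, ?g y} | y. y \<in> {1..a} \<and> ?g y \<noteq> y}"
      by blast
  qed
  moreover have "{{y, ?g y} | y. y \<in> {a + 1..a + sum_list u} \<and> ?g y \<noteq> y} = image ((+) a) ` arcs u"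
  proof (intro equalityI subsetI)
    fix S
    assume "S \<in> {{y, ?g y} | y. y \<in> {a + 1..a + sum_list u} \<and> ?g y \<noteq> y}"
    then obtain z where z: "z \<in> {a + 1..a + sum_list u}" "?g z \<noteq> z" "S = {z, ?g z}"
      by blast
    define y where "y = z - a"
    have y: "z = a + y" "y \<in> {1..sum_list u}"
      using z(1) by (auto simp: y_def)
    then have "?f y \<noteq> y" "S = (+) a ` {y, ?f y}"
      using z high[of y] by auto
    then show "S \<in> image ((+) a) ` arcs u"
      using y unfolding Cons.IH by blast
  next
    fix S
    assume "S \<in> image ((+) a) ` arcs u"
    then obtain y where y: "y \<in> {1..sum_list u}" "?f y \<noteq> y" "S = (+) a ` {y, ?f y}"
      unfolding Cons.IH by blast
    then have "a + y \<in> {a + 1..a + sum_list u}" "?g (a + y) \<noteq> a + y" "S = {a + y, ?g (a + y)}"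
      using high[of y] by auto
    then show "S \<in> {{y, ?g y} | y. y \<in> {a + 1..a + sum_list u} \<and> ?g y \<noteq> y}"
      by blast
  qed
  moreover have "{{y, ?g y} | y. y \<in> {1..sum_list (a # u)} \<and> ?g y \<noteq> y} =
      {{y, ?g y} | y. y \<in> {1..a} \<and> ?g y \<noteq> y} \<union> {{y, ?g y} | y. y \<in> {a + 1..a + sum_list u} \<and> ?g y \<noteq> y}"
  proof -
    have split: "{1..sum_list (a # u)} = {1..a} \<union> {a + 1..a + sum_list u}"
      by auto
    show ?thesis
      unfolding split by blast
  qed
  ultimately show ?case
    by (simp only: arcs_Cons)
qed

lemma meander_index_eq_cyc:
  assumes "sum_list u = n" "sum_list v = n"
  shows "meander_index (u, v) = cyc [] u v"
proof -
  let ?s = "shift 1 (flip u)" and ?t = "shift 1 (flip v)" and ?V = "Suc ` {..<n}"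
  have V: "?V = {1..n}"
    by (simp add: image_Suc_lessThan)
  have perm: "shift 1 (flip w) permutes {1..n}" if "sum_list w = n" for w
  proof (rule permutes_if_involution)
    show "shift 1 (flip w) x = x" if "x \<notin> {1..n}" for x
      using that \<open>sum_list w = n\<close> flip_outside[of w "x - 1"] by (auto simp: shift_def not_le)
  qed (simp add: shift_comp)
  interpret involution_pair "{1..n}" ?s ?t Upper Lower
  proof
    show "?s permutes {1..n}" "?t permutes {1..n}"
      using perm assms by auto
  qed (auto simp: shift_def)
  have "meander_edges (u, v) = edges"
    by (simp only: meander_edges_def edges_def arcs_eq assms fst_conv snd_conv)
  then have "meander_index (u, v) = ncyc (?s \<circ> ?t) {1..n}"
    using index_eq_ncyc assms by (simp add: meander_index_def meander_vertices_def)
  also have "\<dots> = ncyc (?s \<circ> ?t) ?V"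
    by (simp only: V)
  also have "\<dots> = ncyc (flip u \<circ> flip v) {..<n}"
    by (rule ncyc_image[where A = "{..<n}"])
      (auto intro!: permutes_compose flip_permutes simp: assms shift_def)
  also have "\<dots> = cyc [] u v"
  proof -
    have "lperm [] = id"
      by (simp add: lperm_def fun_eq_iff)
    then show ?thesis
      by (simp add: cyc_def assms)
  qed
  finally show ?thesis .
qed

subsection \<open>The transfer system for blocks of size 1 and 7\<close>

definition part_lists :: "nat set \<Rightarrow> nat \<Rightarrow> nat list set" where
  "part_lists J n = {u. set u \<subseteq> J \<and> sum_list u = n}"

lemma finite_part_lists:
  assumes "0 \<notin> J"
  shows "finite (part_lists J n)"
proof (rule finite_subset)
  have "length u \<le> sum_list u" if "0 \<notin> set u" for u :: "nat list"
    using that by (induction u) auto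
  moreover have "set u \<subseteq> {..sum_list u}" for u :: "nat list"
    using member_le_sum_list by auto
  ultimately show "part_lists J n \<subseteq> {u. set u \<subseteq> {..n} \<and> length u \<le> n}"
    using assms by (auto simp: part_lists_def subset_iff)
  show "finite {u. set u \<subseteq> {..n} \<and> length u \<le> n}"
    by (simp add: finite_lists_length_le)
qed

lemma part_lists_0: "0 \<notin> J \<Longrightarrow> part_lists J 0 = {[]}"
  by (auto simp: part_lists_def subset_iff) (metis list.set_intros(1) list.set_cases neq_Nil_conv)

lemma sum_part_lists_17:
  assumes "0 < n"
  shows "(\<Sum>u\<in>part_lists {1, 7} n. h u) = (\<Sum>u\<in>part_lists {1, 7} (n - 1). h (1 # u))
    + (if 7 \<le> n then \<Sum>u\<in>part_lists {1, 7} (n - 7). h (7 # u) else 0)"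
proof -
  let ?P = "part_lists {1, 7}"
  let ?B = "if 7 \<le> n then (#) 7 ` ?P (n - 7) else {}"
  have fin: "finite (?P k)" for k
    by (simp add: finite_part_lists)
  have "u \<in> ?P n \<longleftrightarrow> u \<in> (#) 1 ` ?P (n - 1) \<union> ?B" for u
    using assms by (cases u) (auto simp: part_lists_def image_iff)
  then have "?P n = (#) 1 ` ?P (n - 1) \<union> ?B"
    by blast
  moreover have "(#) 1 ` ?P (n - 1) \<inter> ?B = {}"
    by auto
  ultimately have "sum h (?P n) = sum h ((#) 1 ` ?P (n - 1)) + sum h ?B"
    using fin by (simp add: sum.union_disjoint)
  then show ?thesis
    by (simp add: sum.reindex)
qed

text \<open>\<open>x\<close> marks the size left on the side ahead; the side behind has
  \<open>length L\<close> more. The inner variable \<open>y\<close> marks the cycles still to be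
  closed.\<close>

definition state_gf :: "nat list \<Rightarrow> rat fps fps" where
  "state_gf L = Abs_fps (\<lambda>n. \<Sum>u\<in>part_lists {1, 7} n.
     \<Sum>v\<in>part_lists {1, 7} (n + length L). fps_X ^ cyc L u v)"

text \<open>The contribution of a next block \<open>a\<close> on the side behind. If it overtakes,
  the side of \<open>v\<close> becomes the one ahead, and its remaining size is \<open>a - d\<close>
  below that of \<open>u\<close>; the power of \<open>X\<close> restores this difference.\<close>

definition step_gf :: "nat list \<Rightarrow> nat \<Rightarrow> rat fps fps" where
  "step_gf L a = (let d = length L in
     if a \<le> d then let K = rev (take a L) @ drop a L in
       Y ^ closed_cycles a K * state_gf (trim a K)
     else let K = rev (L @ [d..<a]) in
       X ^ (a - d) * (Y ^ closed_cycles d K * state_gf (trim d K)))"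

lemma Y_power_mult_nth: "(Y ^ c * F) $ n = fps_X ^ c * F $ n"
  by (simp add: fps_const_power)

lemma step_gf_nth:
  assumes "invol L"
  shows "step_gf L a $ n = (\<Sum>u\<in>part_lists {1, 7} n.
    if a \<le> n + length L then \<Sum>v\<in>part_lists {1, 7} (n + length L - a). fps_X ^ cyc L u (a # v) else 0)"
proof (cases "a \<le> length L")
  case True
  let ?K = "rev (take a L) @ drop a L"
  have "(\<Sum>u\<in>part_lists {1, 7} n. \<Sum>v\<in>part_lists {1, 7} (n + length L - a).
      fps_X ^ cyc L u (a # v) :: rat fps) =
    (\<Sum>u\<in>part_lists {1, 7} n. \<Sum>v\<in>part_lists {1, 7} (n + length L - a).
      fps_X ^ closed_cycles a ?K * fps_X ^ cyc (trim a ?K) u v)"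
    using True cyc_Cons_short[OF assms True]
    by (intro sum.cong refl) (simp add: part_lists_def power_add)
  then show ?thesis
    using True by (simp add: step_gf_def Let_def Y_power_mult_nth state_gf_def sum_distrib_left)
next
  case False
  let ?P = "part_lists {1, 7}" and ?d = "length L"
  let ?K = "rev (L @ [?d..<a])"
  have "step_gf L a $ n = (if n < a - ?d then 0 else fps_X ^ closed_cycles ?d ?K *
      (\<Sum>v\<in>?P (n - (a - ?d)). \<Sum>u\<in>?P n. fps_X ^ cyc (trim ?d ?K) v u))"
    using False by (simp add: step_gf_def Let_def fps_X_power_mult_nth Y_power_mult_nth state_gf_def)
  also have "\<dots> = (if a \<le> n + ?d then \<Sum>u\<in>?P n. \<Sum>v\<in>?P (n + ?d - a).
      fps_X ^ closed_cycles ?d ?K * fps_X ^ cyc (trim ?d ?K) v u else 0)"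
  proof -
    have *: "n + ?d - a = n - (a - ?d)" "a \<le> n + ?d \<longleftrightarrow> \<not> n < a - ?d"
      using False by auto
    \<comment> \<open>After overtaking, \<open>v\<close> is the list of the side ahead, so the order
      of summation changes.\<close>
    show ?thesis
      unfolding * sum_distrib_left
      by (cases "n < a - ?d") (simp_all only: if_True if_False not_True_eq_False not_False_eq_True, rule sum.swap)
  qed
  also have "\<dots> = (if a \<le> n + ?d then \<Sum>u\<in>?P n. \<Sum>v\<in>?P (n + ?d - a).
      fps_X ^ cyc L u (a # v) else 0)"
    using False cyc_Cons_long[OF assms, of a]
    by (intro if_cong sum.cong refl) (simp add: part_lists_def power_add)
  finally show ?thesis
    by simp
qed

text \<open>With pending nodes, the side behind cannot be finished, so it has a next block, of size
  1 or 7.\<close>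

lemma state_gf_step:
  assumes "invol L" "L \<noteq> []"
  shows "state_gf L = step_gf L 1 + step_gf L 7"
proof (rule fps_ext)
  fix n
  have "(\<Sum>v\<in>part_lists {1, 7} (n + length L). fps_X ^ cyc L u v) =
      (if 1 \<le> n + length L then \<Sum>v\<in>part_lists {1, 7} (n + length L - 1). fps_X ^ cyc L u (1 # v) else 0)
    + (if 7 \<le> n + length L then \<Sum>v\<in>part_lists {1, 7} (n + length L - 7). fps_X ^ cyc L u (7 # v) else 0
        :: rat fps)" for u
  proof -
    have "0 < n + length L" "1 \<le> n + length L"
      using assms(2) by (cases L; simp)+
    then show ?thesis
      by (simp only: sum_part_lists_17 if_True)
  qed
  then show "state_gf L $ n = (step_gf L 1 + step_gf L 7) $ n"
    by (simp only: step_gf_nth[OF assms(1)] fps_add_nth sum.distrib[symmetric]) (simp add: state_gf_def)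
qed

text \<open>The constant 1 is the empty meander. Otherwise a first block is placed on the side of
  \<open>u\<close>, whose remaining size drops by 1 or 7.\<close>

lemma state_gf_Nil:
  "state_gf [] = 1 + X * state_gf [0] + X ^ 7 * state_gf [6, 5, 4, 3, 2, 1, 0]"
proof (rule fps_ext)
  fix n
  show "state_gf [] $ n =
    (1 + X * state_gf [0] + X ^ 7 * state_gf [6, 5, 4, 3, 2, 1, 0]) $ n"
  proof (cases "n = 0")
    case True
    then show ?thesis
      by (simp add: state_gf_def part_lists_0 cyc_def ncyc_def fps_X_power_mult_nth)
  next
    case False
    have "rev [0..<1] = [0]" "rev [0..<7] = [6, 5, 4, 3, 2, 1, 0]"
      by (simp_all add: upt_rec)
    then have "cyc [] (1 # u) v = cyc [0] u v" "cyc [] (7 # u) v = cyc [6, 5, 4, 3, 2, 1, 0] u v" for u v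
      using cyc_Nil_Cons[of 1] cyc_Nil_Cons[of 7] by simp_all
    moreover have "Suc (Suc (Suc (Suc (Suc (Suc (Suc (n - 7))))))) = n" if "\<not> n < 7"
      using that by simp
    ultimately show ?thesis
      using False sum_part_lists_17[of n "\<lambda>u. \<Sum>v\<in>part_lists {1, 7} n. fps_X ^ cyc [] u v :: rat fps"]
      by (auto simp: state_gf_def fps_X_power_mult_nth)
  qed
qed

lemmas step_simps = step_gf_def Let_def upt_rec numeral_eq_Suc

text \<open>The eight states below are the only ones reachable from the empty state. Each is an involution,
  so exchanging the two sides needs no inversion.\<close>

lemma state_equations:
  "state_gf [0] = Y * state_gf [] + X ^ 6 * state_gf [4, 3, 2, 1, 0, 5]"
  "state_gf [6, 5, 4, 3, 2, 1, 0] = state_gf [4, 3, 2, 1, 0, 5] + Y ^ 7 * state_gf []"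
  "state_gf [4, 3, 2, 1, 0, 5] = state_gf [2, 1, 0, 3, 4] + X * (Y * state_gf [0])"
  "state_gf [2, 1, 0, 3, 4] = state_gf [0, 1, 2, 3] + X ^ 2 * (Y * state_gf [0, 1])"
  "state_gf [0, 1, 2, 3] = Y * state_gf [0, 1, 2] + X ^ 3 * (Y * state_gf [0, 1, 2])"
  "state_gf [0, 1] = Y * state_gf [0] + X ^ 5 * state_gf [2, 1, 0, 3, 4]"
  "state_gf [0, 1, 2] = Y * state_gf [0, 1] + X ^ 4 * state_gf [0, 1, 2, 3]"
  by (subst state_gf_step; simp add: step_simps invol_def All_less_Suc)+

text \<open>Elimination works back from the longest detour: \<open>F7\<close> and \<open>F5\<close>
  in terms of \<open>F6\<close>, then \<open>F6\<close>, \<open>F4\<close> and \<open>F3\<close> in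
  terms of \<open>F1\<close>, then \<open>F1\<close> and \<open>F3\<close> in terms of
  \<open>F0\<close>.\<close>

lemma state_gf_17: "state_gf [] * g17 = f17"
proof -
  define F0 where "F0 = state_gf []"
  define F1 where "F1 = state_gf [0]"
  define F2 where "F2 = state_gf [6, 5, 4, 3, 2, 1, 0]"
  define F3 where "F3 = state_gf [4, 3, 2, 1, 0, 5]"
  define F4 where "F4 = state_gf [2, 1, 0, 3, 4]"
  define F5 where "F5 = state_gf [0, 1, 2, 3]"
  define F6 where "F6 = state_gf [0, 1]"
  define F7 where "F7 = state_gf [0, 1, 2]"
  define x y where "x = X" and "y = Y"
  note defs = F0_def F1_def F2_def F3_def F4_def F5_def F6_def F7_def x_def y_def
  have eqs: "F0 = 1 + x * F1 + x ^ 7 * F2" "F1 = y * F0 + x ^ 6 * F3" "F2 = F3 + y ^ 7 * F0"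
    "F3 = F4 + x * (y * F1)" "F4 = F5 + x\<^sup>2 * (y * F6)" "F5 = y * F7 + x ^ 3 * (y * F7)"
    "F6 = y * F1 + x ^ 5 * F4" "F7 = y * F6 + x ^ 4 * F5"
    unfolding defs by (fact state_gf_Nil state_equations)+
  \<comment> \<open>\<open>D\<close> is the determinant of the equations for \<open>F5\<close> and
    \<open>F7\<close>. \<open>N4\<close> is the numerator of \<open>F4\<close> over \<open>D\<close>
    in terms of \<open>F6\<close>, and \<open>Q\<close> is the determinant left after solving for
    \<open>F6\<close>.\<close>
  define D where "D = 1 - x ^ 4 * y - x ^ 7 * y"
  define N4 where "N4 = y\<^sup>2 * (1 + x ^ 3) + x\<^sup>2 * y * D"
  define Q where "Q = D - x ^ 5 * N4"
  have "D * F7 = y * F6"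
    using eqs(6,8) unfolding D_def by algebra
  then have DF4: "D * F4 = N4 * F6"
    using eqs(5,6) unfolding N4_def by algebra
  have "Q * F6 = y * D * F1"
    using DF4 eqs(7) unfolding Q_def by algebra
  then have "D * (Q * F4) = D * (y * N4 * F1)"
    using DF4 by algebra
  \<comment> \<open>Constant coefficient 1 makes both factors nonzero, and bivariate power series
    form an integral domain, so they cancel.\<close>
  moreover have nz: "D \<noteq> 0" "Q \<noteq> 0"
  proof -
    have "D $ 0 = 1"
      by (simp add: D_def x_def fps_mult_nth_0 fps_power_zeroth)
    moreover from this have "Q $ 0 = 1"
      by (simp add: Q_def x_def fps_mult_nth_0 fps_power_zeroth)
    ultimately show "D \<noteq> 0" "Q \<noteq> 0"
      by auto
  qed
  ultimately have F4: "Q * F4 = y * N4 * F1"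
    by simp
  have F3: "Q * F3 = (y * N4 + x * y * Q) * F1"
    using F4 eqs(4) by algebra
  \<comment> \<open>The determinant left after eliminating \<open>F3\<close> from the equation for
    \<open>F1\<close>; it turns out to be \<open>f17\<close>.\<close>
  define f where "f = Q - x ^ 6 * (y * N4 + x * y * Q)"
  have F1: "f * F1 = y * Q * F0"
    using F3 eqs(2) unfolding f_def by algebra
  have "Q * (f * F3) = Q * ((y * N4 + x * y * Q) * y * F0)"
    using F1 F3 by algebra
  then have F3': "f * F3 = (y * N4 + x * y * Q) * y * F0"
    using nz by simp
  have "F0 * (f * (1 - x ^ 7 * y ^ 7) - x * y * Q - x ^ 7 * (y * N4 + x * y * Q) * y) = f"
    using eqs(1,3) F1 F3' by algebra
  moreover have "f = f17"
    unfolding f_def Q_def N4_def D_def f17_def x_def y_def by algebra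
  moreover have "f * (1 - x ^ 7 * y ^ 7) - x * y * Q - x ^ 7 * (y * N4 + x * y * Q) * y = g17"
    unfolding g17_def \<open>f = f17\<close>[symmetric]
    unfolding f_def Q_def N4_def D_def x_def y_def by algebra
  ultimately show ?thesis
    by (simp add: F0_def)
qed

section \<open>Meander counts as coefficients of the empty state\<close>

definition list_pairs :: "nat set \<Rightarrow> nat \<Rightarrow> (nat list \<times> nat list) set" where
  "list_pairs J n = part_lists J n \<times> part_lists J n"

lemma meander_count_eq:
  assumes "0 \<notin> J"
  shows "meander_count J n k = card {(u, v) \<in> list_pairs J n. cyc [] u v = k}"
proof -
  have "{m. is_meander n m \<and> set (fst m) \<subseteq> J \<and> set (snd m) \<subseteq> J \<and> meander_index m = k}
      = {(u, v) \<in> list_pairs J n. cyc [] u v = k}"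
  proof -
    have *: "(is_meander n (u, v) \<and> set u \<subseteq> J \<and> set v \<subseteq> J \<and> meander_index (u, v) = k)
        \<longleftrightarrow> (u, v) \<in> list_pairs J n \<and> cyc [] u v = k" for u v
    proof -
      have "\<forall>a\<in>set w. 0 < a" if "set w \<subseteq> J" for w
        using assms that by (metis gr0I subsetD)
      then show ?thesis
        using meander_index_eq_cyc[of u n v]
        by (auto simp: is_meander_def is_composition_def list_pairs_def part_lists_def)
    qed
    show ?thesis
    proof (rule set_eqI)
      fix m
      show "m \<in> {m. is_meander n m \<and> set (fst m) \<subseteq> J \<and> set (snd m) \<subseteq> J \<and> meander_index m = k}
          \<longleftrightarrow> m \<in> {(u, v) \<in> list_pairs J n. cyc [] u v = k}"
        by (cases m) (simp only: mem_Collect_eq case_prod_conv fst_conv snd_conv *)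
    qed
  qed
  then show ?thesis
    by (simp add: meander_count_def)
qed

lemma meander_gf_17: "meander_gf {1, 7} = state_gf []"
proof (intro fps_ext)
  fix n k
  let ?P = "list_pairs {1, 7} n"
  have fin: "finite ?P"
    by (simp add: list_pairs_def finite_part_lists)
  have "state_gf [] $ n $ k = (\<Sum>(u, v)\<in>?P. if cyc [] u v = k then 1 else 0)"
    by (auto simp: state_gf_def fps_sum_nth sum.cartesian_product fps_X_power_nth list_pairs_def
        intro!: sum.cong)
  also have "\<dots> = (\<Sum>m\<in>{m \<in> ?P. cyc [] (fst m) (snd m) = k}. 1)"
    using sum.inter_filter[OF fin, of "\<lambda>_. 1 :: rat" "\<lambda>m. cyc [] (fst m) (snd m) = k"]
    by (simp add: case_prod_unfold)
  also have "\<dots> = of_nat (card {(u, v) \<in> ?P. cyc [] u v = k})"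
    by (simp add: case_prod_unfold)
  finally show "meander_gf {1, 7} $ n $ k = state_gf [] $ n $ k"
    by (simp add: meander_gf_def meander_count_eq)
qed

subsection \<open>Rescaling the block sizes\<close>

text \<open>In a block stretched to \<open>c * a\<close> positions, the mirror image of
  \<open>c * x + r\<close> is \<open>c * (a - 1 - x) + (c - 1 - r)\<close>.\<close>

lemma flip_map_mult:
  assumes "r < c" "x < sum_list u"
  shows "flip (map ((*) c) u) (c * x + r) = c * flip u x + (c - 1 - r)"
  using assms(2)
proof (induction u arbitrary: x)
  case Nil
  then show ?case by simp
next
  case (Cons a u)
  show ?case
  proof (cases "x < a")
    case True
    then obtain b where b: "a = x + Suc b"
      using less_natE by auto
    have "c * x + r < c * a"
      using assms(1) by (simp add: b algebra_simps)
    moreover have "c * a - 1 - (c * x + r) = c * b + (c - 1 - r)"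
      using assms(1) by (simp add: b algebra_simps)
    ultimately show ?thesis
      by (simp add: b)
  next
    case False
    then obtain y where y: "x = a + y"
      using le_Suc_ex by (meson not_less)
    have "flip (map ((*) c) u) (c * y + r) = c * flip u y + (c - 1 - r)"
      using Cons by (simp add: y)
    moreover have "c * x + r = c * a + (c * y + r)"
      by (simp add: y algebra_simps)
    ultimately show ?thesis
      by (simp add: y add_mult_distrib2)
  qed
qed

text \<open>Each residue class modulo \<open>c\<close> is invariant under \<open>g\<close> and
  carries a copy of \<open>f\<close>.\<close>

lemma ncyc_scale:
  assumes f: "f permutes {..<n}" and g: "\<And>x r. x < n \<Longrightarrow> r < c \<Longrightarrow> g (c * x + r) = c * f x + r"
  shows "ncyc g {..<c * n} = c * ncyc f {..<n}"
proof -
  let ?A = "\<lambda>r. (\<lambda>x. c * x + r) ` {..<n}"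
  have closed: "orbit g y \<subseteq> ?A r" if "y \<in> ?A r" "r < c" for y r
  proof
    have step: "g z \<in> ?A r" if "z \<in> ?A r" for z
      using that g[OF _ \<open>r < c\<close>] permutes_in_image[OF f] by auto
    show "z \<in> ?A r" if "z \<in> orbit g y" for z
      using that by induction (use \<open>y \<in> ?A r\<close> step in blast)+
  qed
  have single: "ncyc g (?A r) = ncyc f {..<n}" if "r < c" for r
    using that by (intro ncyc_image[OF f]) (auto simp: inj_on_def g)
  have residue: "y mod c = r" if "y \<in> ?A r" "r < c" for y r
    using that by auto
  have "ncyc g (\<Union>r<k. ?A r) = k * ncyc f {..<n}" if "k \<le> c" for k
    using that
  proof (induction k)
    case 0
    show ?case by (simp add: ncyc_def)
  next
    case (Suc k)
    have "(\<Union>r<Suc k. ?A r) = ?A k \<union> (\<Union>r<k. ?A r)"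
      by (simp only: lessThan_Suc UN_insert)
    moreover have "ncyc g (?A k \<union> (\<Union>r<k. ?A r)) = ncyc g (?A k) + ncyc g (\<Union>r<k. ?A r)"
    proof (rule ncyc_Un)
      show "orbit g y \<subseteq> ?A k" if "y \<in> ?A k" for y
        using closed that Suc.prems by simp
      show "orbit g y \<subseteq> (\<Union>r<k. ?A r)" if y: "y \<in> (\<Union>r<k. ?A r)" for y
      proof -
        obtain r where "r < k" "y \<in> ?A r"
          using y by blast
        then show ?thesis
          using closed[of y r] Suc.prems by fastforce
      qed
      show "?A k \<inter> (\<Union>r<k. ?A r) = {}"
      proof (rule equals0I)
        fix y
        assume "y \<in> ?A k \<inter> (\<Union>r<k. ?A r)"
        then obtain r where "r < k" "y \<in> ?A r" "y \<in> ?A k"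
          by blast
        then show False
          using residue[of y r] residue[of y k] Suc.prems by simp
      qed
    qed simp_all
    ultimately show ?case
      using Suc single[of k] by simp
  qed
  moreover have "(\<Union>r<c. ?A r) = {..<c * n}"
  proof (intro equalityI subsetI)
    fix y
    assume "y \<in> (\<Union>r<c. ?A r)"
    then obtain x r where "x < n" "r < c" "y = c * x + r"
      by auto
    moreover have "c * x + c \<le> c * n"
      using mult_le_mono2[of "Suc x" n c] \<open>x < n\<close> by simp
    ultimately show "y \<in> {..<c * n}"
      by simp
  next
    fix y
    assume "y \<in> {..<c * n}"
    then have "0 < c" "y div c < n"
      by (auto simp: less_mult_imp_div_less mult.commute intro: gr0I)
    then have "y \<in> ?A (y mod c)" "y mod c < c"
      by (auto intro!: image_eqI[of _ _ "y div c"])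
    then show "y \<in> (\<Union>r<c. ?A r)"
      by blast
  qed
  ultimately show ?thesis
    by (metis order_refl)
qed

text \<open>Each of the two stretched reversals sends residue \<open>r\<close> to
  \<open>c - 1 - r\<close>, so their composite preserves residues.\<close>

lemma cyc_map_mult:
  assumes "sum_list u = n" "sum_list v = n"
  shows "cyc [] (map ((*) c) u) (map ((*) c) v) = c * cyc [] u v"
proof -
  have cyc: "cyc [] w w' = ncyc (flip w \<circ> flip w') {..<sum_list w'}" for w w'
  proof -
    have "lperm [] = id"
      by (simp add: lperm_def fun_eq_iff)
    then show ?thesis
      by (simp add: cyc_def)
  qed
  have sum: "sum_list (map ((*) c) v) = c * n"
    using sum_list_const_mult[of c id v] assms by simp
  show ?thesis
    unfolding cyc sum assms
  proof (rule ncyc_scale)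
    show "flip u \<circ> flip v permutes {..<n}"
      using assms by (intro permutes_compose flip_permutes) auto
    fix x r
    assume x: "x < n" and r: "r < c"
    have "flip v permutes {..<n}"
      using assms by (intro flip_permutes) auto
    then have "flip v x < n"
      using x permutes_in_image by fastforce
    moreover have "c - 1 - r < c" "c - 1 - (c - 1 - r) = r"
      using r by auto
    ultimately show "(flip (map ((*) c) u) \<circ> flip (map ((*) c) v)) (c * x + r) = c * (flip u \<circ> flip v) x + r"
      using x r assms by (simp only: comp_apply flip_map_mult)
  qed
qed

lemma part_lists_image_mult:
  assumes "0 < c"
  shows "part_lists ((*) c ` J) n = (if c dvd n then map ((*) c) ` part_lists J (n div c) else {})"
proof -
  have sum: "sum_list (map ((*) c) w) = c * sum_list w" for w
    using sum_list_const_mult[of c id w] by simp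
  have pre: "\<exists>w. set w \<subseteq> J \<and> u = map ((*) c) w" if "set u \<subseteq> (*) c ` J" for u
    using that
  proof (induction u)
    case Nil
    show ?case by simp
  next
    case (Cons a u)
    then obtain w b where "set w \<subseteq> J" "u = map ((*) c) w" "b \<in> J" "a = c * b"
      by auto
    then show ?case
      by (intro exI[of _ "b # w"]) auto
  qed
  show ?thesis
  proof (intro equalityI subsetI)
    fix u
    assume "u \<in> part_lists ((*) c ` J) n"
    then have u: "set u \<subseteq> (*) c ` J" "sum_list u = n"
      by (simp_all add: part_lists_def)
    then obtain w where "set w \<subseteq> J" "u = map ((*) c) w" "n = c * sum_list w"
      using pre[OF u(1)] sum by blast
    then show "u \<in> (if c dvd n then map ((*) c) ` part_lists J (n div c) else {})"
      using assms by (auto simp: part_lists_def)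
  next
    fix u
    assume "u \<in> (if c dvd n then map ((*) c) ` part_lists J (n div c) else {})"
    then obtain w where "c dvd n" "set w \<subseteq> J" "sum_list w = n div c" "u = map ((*) c) w"
      by (auto simp: part_lists_def split: if_splits)
    then show "u \<in> part_lists ((*) c ` J) n"
      using image_mono[of "set w" J "(*) c"] sum[of w] by (simp add: part_lists_def)
  qed
qed

lemma meander_count_image_mult:
  assumes "0 < c" "0 \<notin> J"
  shows "meander_count ((*) c ` J) n k =
    (if c dvd n \<and> c dvd k then meander_count J (n div c) (k div c) else 0)"
proof -
  have J: "0 \<notin> (*) c ` J"
    using assms by auto
  have inj: "inj (map ((*) c))"
    using assms(1) by (intro list.inj_map) (simp add: inj_on_def)
  let ?h = "map_prod (map ((*) c)) (map ((*) c))"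
  have pairs: "list_pairs ((*) c ` J) n = (if c dvd n then ?h ` list_pairs J (n div c) else {})"
    using assms(1) by (auto simp: list_pairs_def part_lists_image_mult)
  have cyc: "cyc [] (map ((*) c) u) (map ((*) c) v) = c * cyc [] u v" if "(u, v) \<in> list_pairs J i" for u v i
    using that by (intro cyc_map_mult[of _ i]) (auto simp: list_pairs_def part_lists_def)
  have "{(u, v) \<in> list_pairs ((*) c ` J) n. cyc [] u v = k} =
    (if c dvd n \<and> c dvd k then ?h ` {(u, v) \<in> list_pairs J (n div c). cyc [] u v = k div c} else {})"
    using assms(1) by (auto simp: pairs cyc)
  moreover have "inj ?h"
    using inj inj by (rule prod.inj_map)
  ultimately show ?thesis
    using card_image[OF inj_on_subset[OF \<open>inj ?h\<close>]]
    by (simp add: meander_count_eq[OF J] meander_count_eq[OF assms(2)])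
qed

text \<open>The \<open>i\<close>-th power of \<open>fps_X ^ c\<close> contributes only at
  \<open>c * i\<close>, and for positive \<open>c\<close> at most one \<open>i\<close> gives
  \<open>n\<close>.\<close>

lemma fps_compose_X_power_nth:
  assumes "0 < c"
  shows "fps_compose F (fps_X ^ c) $ n = (if c dvd n then F $ (n div c) else 0)"
proof -
  have "fps_compose F (fps_X ^ c) $ n = (\<Sum>i=0..n. if n = c * i then F $ i else 0)"
    by (auto simp: fps_compose_nth fps_X_power_nth intro!: sum.cong simp flip: power_mult)
  also have "\<dots> = (\<Sum>i=0..n. if c dvd n \<and> i = n div c then F $ i else 0)"
    using assms by (intro sum.cong) auto
  also have "\<dots> = (if c dvd n then F $ (n div c) else 0)"
    by auto
  finally show ?thesis .
qed

lemma subst_powers_nth: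
  assumes "0 < c"
  shows "subst_powers c F $ n $ k = (if c dvd n \<and> c dvd k then F $ (n div c) $ (k div c) else 0)"
  using assms by (simp add: subst_powers_def fps_compose_X_power_nth)

theorem theorem3p9:
  shows "meander_gf {1, 7} = f17 / g17 \<and>
    (\<forall>c\<ge>1. meander_gf {c, 7 * c} = subst_powers c (meander_gf {1, 7}))"
proof (intro conjI allI impI)
  show "meander_gf {1, 7} = f17 / g17"
    unfolding meander_gf_17 divide_g17_iff by (rule state_gf_17)
next
  fix c :: nat
  assume c: "1 \<le> c"
  have J: "{c, 7 * c} = (*) c ` {1, 7}"
    by auto
  show "meander_gf {c, 7 * c} = subst_powers c (meander_gf {1, 7})"
  proof (intro fps_ext)
    fix n k
    show "meander_gf {c, 7 * c} $ n $ k = subst_powers c (meander_gf {1, 7}) $ n $ k"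
      unfolding J using c meander_count_image_mult[of c "{1, 7}" n k]
      by (simp add: meander_gf_def subst_powers_nth del: image_insert)
  qed
qed

end
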